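(* Let $(a_1,\dots,a_n)\in\mathcal J^n$, $n\ge1$, be an admissible sequence such that the cylinder set $\langle a_1,\dots,a_n\rangle$ is not full. Then, up to a set of Lebesgue measure $0$, $T^n(\langle a_1,\dots,a_n\rangle)$ is equal to one of the sets $U_{k,\ell}$, $1\le k\le5$, $1\le\ell\le6$, and it is, up to a set of Lebesgue measure $0$, a finite union of elements of $\mathcal V=\{V_{k,\ell}:1\le k,\ell\le 6\}$. Hence $T$ has a finite range structure, i.e. the family $$\{(T^n(\langle a_1,\dots,a_n\rangle))^\circ : (a_1,\dots,a_n)\text{ admissible},\ n\ge1\}$$ is a finite set.
   Context: Let $\zeta=\frac{1+\sqrt{-3}}2$, $\eta=\frac{3+\sqrt{-3}}2$, $\mathfrak o(\sqrt{-3})=\mathbb Z+\mathbb Z\zeta$, $\mathcal J=\eta\cdot\mathfrak o(\sqrt{-3})$. $U$ is the fundamental domain of $\mathbb C/\mathcal J$ consisting of the open regular hexagon with vertices $\zeta^k$ ($0\le k\le 5$), together with the three open sides $\{t\zeta+(1-t)(-\overline\zeta):0<t<1\}$, $\{t(-\zeta)+(1-t)(-1):0<t<1\}$, $\{t+(1-t)\overline\zeta:0<t<1\}$ and the two vertices $-\zeta,\overline\zeta$. For $z\in\mathbb C$, $[z]$ is the unique $a\in\mathcal J$ with $z\in a+U$. The map $T:U\to U$ is $T(z)=\frac1z-[\frac1z]$ for $z\ne0$, $T(0)=0$; $b_n(z)=[1/T^{n-1}(z)]$ (with $b_n(z)=\infty$ if $T^{n-1}(z)=0$). For $(a_1,\dots,a_n)\in\mathcal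 J^n$, the cylinder set is $\langle a_1,\dots,a_n\rangle=\{z\in U: b_1(z)=a_1,\dots,b_n(z)=a_n\}$. The sequence is admissible if its cylinder set has an interior point. $A^\circ$ denotes the interior of $A$. A cylinder set is full if $(T^n(\langle a_1,\dots,a_n\rangle))^\circ=U_0$, where $U_0:=U^\circ$. Write $z=x+yi$ and $r=\frac{\sqrt3}3$. Put $U_{1,1}=U_0\cap\{|z+\frac23\eta|>r\}$, $U_{2,1}=U_0\cap\{|z+\frac13\eta|>r\}$, $U_{3,1}=U_0\cap\{y>\sqrt3x\}$, $U_{4,1}=U_{1,1}\cap\{y>\sqrt3x\}$, $U_{5,1}=(\zeta U_{1,1})\cap\{y<\sqrt3x\}$, and $U_{k,\ell}=\zeta^{\ell-1}U_{k,1}$ for $1\le k\le5$, $1\le\ell\le6$. Put $V_{1,1}=\{z\in U:|z-\frac13\overline\eta|<r,\ |z-\frac13\sqrt{-3}|<r\}$, $V_{2,1}=\{z\in U:|z-\frac23\eta|>r,\ |z-\frac13\sqrt{-3}|>r,\ x>0,\ y>0\}$, $V_{3,1}=\{z\in U:|z-\frac23\eta|>r,\ |z-\frac13\overline\eta|>r,\ y>0,\ y<\sqrt3x\}$, $V_{4,1}=\{z\in U:|z-\frac13\overline\eta|<r,\ |z-\frac23\eta|<r\}$, $V_{5,1}=\{z\in U:|z-\frac23\eta|<r,\ |z-\frac13\sqrt{-3}|<r\}$, $V_{6,1}=\{z\in U:|z-\frac13\overline\eta|>r,\ |z-\frac13\sqrt{-3}|>r,\ x>0,\ y>0\}$, and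 $V_{k,\ell}=\zeta^{\ell-1}V_{k,1}$ for $1\le k,\ell\le6$. *)

theory Defs
  imports "HOL-Analysis.Analysis"
begin

abbreviation sqrt_minus3 :: complex where
  "sqrt_minus3 \<equiv> \<i> * complex_of_real (sqrt 3)"

definition zeta :: complex where
  "zeta = (1 + sqrt_minus3) / 2"

definition eta :: complex where
  "eta = (3 + sqrt_minus3) / 2"

definition eisenstein_ints :: "complex set" where
  "eisenstein_ints = {of_int m + of_int n * zeta | m n. True}"

definition J :: "complex set" where
  "J = (\<lambda>w. eta * w) ` eisenstein_ints"

definition open_hexagon :: "complex set" where
  "open_hexagon = interior (convex hull {zeta ^ k | k. k \<le> 5})"

text \<open>
  Exactly one of each pair of opposite sides and one of each class of vertices modulo
  \<^term>\<open>J\<close> belongs to the fundamental domain.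
\<close>

definition U :: "complex set" where
  "U = open_hexagon
     \<union> open_segment zeta (- cnj zeta)
     \<union> open_segment (- zeta) (- 1)
     \<union> open_segment 1 (cnj zeta)
     \<union> {- zeta, cnj zeta}"

definition U0 :: "complex set" where
  "U0 = interior U"

definition nearest :: "complex \<Rightarrow> complex" where
  "nearest z = (THE a. a \<in> J \<and> z \<in> (\<lambda>u. a + u) ` U)"

definition T :: "complex \<Rightarrow> complex" where
  "T z = (if z = 0 then 0 else 1 / z - nearest (1 / z))"

text \<open>The value \<^term>\<open>None\<close> stands for the digit \<open>\<infinity>\<close>; digits are numbered from 1.\<close>

definition digit :: "nat \<Rightarrow> complex \<Rightarrow> complex option" where
  "digit n z = (let w = (T ^^ (n - 1)) z in if w = 0 then None else Some (nearest (1 / w)))"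

definition cylinder :: "complex list \<Rightarrow> complex set" where
  "cylinder as = {z \<in> U. \<forall>i<length as. digit (Suc i) z = Some (as ! i)}"

definition cylinder_range :: "complex list \<Rightarrow> complex set" where
  "cylinder_range as = (T ^^ length as) ` cylinder as"

definition admissible :: "complex list \<Rightarrow> bool" where
  "admissible as \<longleftrightarrow> set as \<subseteq> J \<and> interior (cylinder as) \<noteq> {}"

definition full_cylinder :: "complex list \<Rightarrow> bool" where
  "full_cylinder as \<longleftrightarrow> interior (cylinder_range as) = U0"

definition eq_ae :: "complex set \<Rightarrow> complex set \<Rightarrow> bool" where
  "eq_ae A B \<longleftrightarrow> sym_diff A B \<in> null_sets lebesgue"

definition rad :: real where
  "rad = sqrt 3 / 3"

definition U11 :: "complex set" where
  "U11 = U0 \<inter> {z. cmod (z + 2 / 3 * eta) > rad}"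

definition U21 :: "complex set" where
  "U21 = U0 \<inter> {z. cmod (z + 1 / 3 * eta) > rad}"

definition U31 :: "complex set" where
  "U31 = U0 \<inter> {z. Im z > sqrt 3 * Re z}"

definition U41 :: "complex set" where
  "U41 = U11 \<inter> {z. Im z > sqrt 3 * Re z}"

definition U51 :: "complex set" where
  "U51 = (\<lambda>z. zeta * z) ` U11 \<inter> {z. Im z < sqrt 3 * Re z}"

text \<open>
  Both indices of \<open>U_sets\<close> and \<open>V_sets\<close> start at 1; only \<open>1 \<le> k \<le> 5\<close>
  (respectively \<open>1 \<le> k \<le> 6\<close>) and \<open>1 \<le> l \<le> 6\<close> are meaningful.
\<close>

definition U_sets :: "nat \<Rightarrow> nat \<Rightarrow> complex set" where
  "U_sets k l = (\<lambda>z. zeta ^ (l - 1) * z) ` ([U11, U21, U31, U41, U51] ! (k - 1))"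

definition V11 :: "complex set" where
  "V11 = {z \<in> U. cmod (z - 1 / 3 * cnj eta) < rad \<and> cmod (z - 1 / 3 * sqrt_minus3) < rad}"

definition V21 :: "complex set" where
  "V21 = {z \<in> U. cmod (z - 2 / 3 * eta) > rad \<and> cmod (z - 1 / 3 * sqrt_minus3) > rad
                \<and> Re z > 0 \<and> Im z > 0}"

definition V31 :: "complex set" where
  "V31 = {z \<in> U. cmod (z - 2 / 3 * eta) > rad \<and> cmod (z - 1 / 3 * cnj eta) > rad
                \<and> Im z > 0 \<and> Im z < sqrt 3 * Re z}"

definition V41 :: "complex set" where
  "V41 = {z \<in> U. cmod (z - 1 / 3 * cnj eta) < rad \<and> cmod (z - 2 / 3 * eta) < rad}"

definition V51 :: "complex set" where
  "V51 = {z \<in> U. cmod (z - 2 / 3 * eta) < rad \<and> cmod (z - 1 / 3 * sqrt_minus3) < rad}"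

definition V61 :: "complex set" where
  "V61 = {z \<in> U. cmod (z - 1 / 3 * cnj eta) > rad \<and> cmod (z - 1 / 3 * sqrt_minus3) > rad
                \<and> Re z > 0 \<and> Im z > 0}"

definition V_sets :: "nat \<Rightarrow> nat \<Rightarrow> complex set" where
  "V_sets k l = (\<lambda>z. zeta ^ (l - 1) * z) ` ([V11, V21, V31, V41, V51, V61] ! (k - 1))"

definition V_family :: "complex set set" where
  "V_family = {V_sets k l | k l. k \<in> {1..6} \<and> l \<in> {1..6}}"

end

theory Submission
  imports Defs
begin

text \<open>
  In the coordinates $p = L_0(z)$, $q = L_1(z)$, i.e. $z = p + q \zeta^2$, the norm is
  $p^2 - pq + q^2$, the hexagon is $|p|, |q|, |p - q| < 1$, and $J$ consists of the integral
  points with $3 \mid p + q$. If $T^n\langle a_1,\dots,a_n\rangle$ agrees up to a null set with an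
  open set $G$, then $T^{n+1}\langle a_1,\dots,a_n,a\rangle$ agrees with the set of all
  $u$ in the hexagon with $1/(u+a) \in G$. A finite family of regions, bounded by sides of the
  hexagon, circles $|z|^2 + 2 L_k(z) + 1 = 0$ and $|z|^2 + L_k(z) = 0$ and diagonals $L_k(z) = 0$,
  is stable under this operation: inversion permutes the circles of the first kind and the
  diagonals, sends circles of the second kind to the side lines $L_k(z) = -1$, and a translation
  by an element of $J$ sends a line $L_k(z) = m$ to a line of the same kind. Only the six
  neighbours $a$ of $0$ in $J$ cut the hexagon by a circle. None of these curves crosses the
  interior of a piece $V_{k,l}$, so every region is a union of pieces up to a null set.
\<close>

section \<open>Hexagonal coordinates\<close>

text \<open>The danger is that every further digit adds another curve to the range. Cuts do not
  accumulate, however. Under a neighbour of 0 the hexagon shrinks to \<open>outer_cut j\<close>, and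
  the pulled back curve either misses this set, or is the circle of \<open>inner_cut j\<close>,
  which supersedes the outer one, or is one of two diagonals. Under any other nonzero lattice point
  circles of the first kind disappear and at most one diagonal is left. Hence the only intersections
  in \<open>regions\<close> are those of an outer cut with the diagonal of index j + 2 or j + 4.

  Two notions of equality have to be served at once: ranges are compared almost everywhere,
  interiors exactly. The induction on the digits yields an open region inside the range with null
  complement there. Regions are regular open sets, so this region is the exact interior, while the
  boundary of the fundamental domain is absorbed into a null set.

  The factor 2 / 3 makes \<open>L k z = 1\<close> the line through the side from zeta^k to
  zeta^(k+1), whose sum is eta zeta^k. Indices are read modulo 6; on natural numbers 5 * k stands
  for -k.\<close>

definition L :: "nat \<Rightarrow> complex \<Rightarrow> real" where
  "L k z = 2 / 3 * Re (z * cnj (eta * zeta ^ k))"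

lemma sqrt3_mult [simp]: "sqrt 3 * sqrt 3 = (3::real)" "sqrt 3 * (sqrt 3 * x) = 3 * (x::real)"
  by (simp, metis abs_numeral mult.assoc real_sqrt_mult_self)

lemma zeta_sel: "Re zeta = 1 / 2" "Im zeta = sqrt 3 / 2"
  and eta_sel: "Re eta = 3 / 2" "Im eta = sqrt 3 / 2"
  by (simp_all add: zeta_def eta_def)

lemma zeta_square: "zeta * zeta = zeta - 1"
  by (simp add: complex_eq_iff zeta_sel)

lemma zeta_cnj: "zeta * cnj zeta = 1" "cnj zeta * zeta = 1"
  by (simp_all add: complex_eq_iff zeta_sel)

lemma zeta_nonzero [simp]: "zeta \<noteq> 0"
  using zeta_cnj by auto

lemma zeta_power_2: "zeta ^ (k + 2) = zeta ^ (k + 1) - zeta ^ k"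
proof -
  have "zeta ^ (k + 2) = zeta ^ k * (zeta * zeta)" by simp
  then show ?thesis by (simp add: zeta_square algebra_simps)
qed

lemma zeta_power_3: "zeta ^ 3 = -1"
  by (simp add: numeral_3_eq_3 zeta_square algebra_simps)

lemma zeta_power_6: "zeta ^ 6 = 1"
proof -
  have "zeta ^ 6 = (zeta ^ 3) ^ 2" by (simp flip: power_mult)
  then show ?thesis by (simp add: zeta_power_3)
qed

lemma norm_zeta [simp]: "cmod zeta = 1"
  by (simp add: cmod_def power2_eq_square zeta_sel)

lemma L_0: "L 0 z = Re z + sqrt 3 / 3 * Im z"
  by (simp add: L_def zeta_sel eta_sel algebra_simps)

lemma L_1: "L 1 z = 2 * sqrt 3 / 3 * Im z"
  by (simp add: L_def zeta_sel eta_sel algebra_simps)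

lemma L_add: "L k (z + w) = L k z + L k w"
  and L_diff: "L k (z - w) = L k z - L k w"
  and L_of_real: "L k (of_real c * z) = c * L k z"
  and L_zero [simp]: "L k 0 = 0"
  by (simp_all add: L_def algebra_simps)

lemma L_inner: "L k z = ((2 / 3) *\<^sub>R (eta * zeta ^ k)) \<bullet> z"
proof -
  have "Re (z * cnj v) = v \<bullet> z" for v
    by (simp add: inner_complex_def algebra_simps)
  then show ?thesis
    unfolding L_def by (simp only: inner_scaleR_left)
qed

lemma L_normal_nonzero: "(2 / 3) *\<^sub>R (eta * zeta ^ k) \<noteq> 0"
  by (simp add: complex_eq_iff[of eta] eta_sel)

lemma L_2: "L (k + 2) z = L (k + 1) z - L k z"
  unfolding L_def zeta_power_2 by (simp add: algebra_simps)

lemma L_3: "L (k + 3) z = - L k z"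
  using L_2[of k z] L_2[of "k + 1" z] by (simp add: eval_nat_numeral)

lemma L_4: "L (k + 4) z = - L (k + 1) z"
  using L_3[of "k + 1" z] by (simp add: eval_nat_numeral)

lemma L_5: "L (k + 5) z = L k z - L (k + 1) z"
  using L_3[of "k + 2" z] L_2[of k z] by (simp add: eval_nat_numeral)

lemma L_6: "L (k + 6) z = L k z"
  using L_3[of "k + 3" z] L_3[of k z] by (simp add: eval_nat_numeral)

lemma L_mod: "L (k mod 6) = L k"
proof -
  have "L (k + 6 * m) z = L k z" for k m z
  proof (induction m)
    case (Suc m)
    then show ?case using L_6[of "k + 6 * m" z] by (simp add: algebra_simps)
  qed simp
  from this[where k = "k mod 6" and m = "k div 6"] show ?thesis by (simp add: fun_eq_iff)
qed

lemma L_cong: "k mod 6 = m mod 6 \<Longrightarrow> L k = L m"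
  by (metis L_mod)

lemma L_index: "\<exists>i<6. L k = L (j + i)"
proof -
  let ?i = "(k + 5 * j) mod 6"
  have "k mod 6 = (j + ?i) mod 6"
  proof -
    have "j + (k + 5 * j) = k + 6 * j" by simp
    then show ?thesis by (simp only: mod_add_right_eq mod_mult_self2)
  qed
  then show ?thesis by (intro exI[of _ ?i]) (simp, rule L_cong)
qed

text \<open>This turns a condition on all six directions into six conditions on two real
  coordinates, where real arithmetic can finish.\<close>

lemma L_all: "(\<forall>k. P (L k z)) \<longleftrightarrow> P (L j z) \<and> P (L (j + 1) z) \<and> P (L (j + 1) z - L j z) \<and>
    P (- L j z) \<and> P (- L (j + 1) z) \<and> P (L j z - L (j + 1) z)" (is "?l \<longleftrightarrow> ?r")
proof
  assume ?l
  then have "P (L j z)" "P (L (j + 1) z)" "P (L (j + 2) z)" "P (L (j + 3) z)" "P (L (j + 4) z)" "P (L (j + 5) z)"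
    by blast+
  then show ?r unfolding L_2 L_3 L_4 L_5 by blast
next
  assume r: ?r
  show ?l
  proof
    fix k
    obtain i where "i < 6" and k: "L k = L (j + i)" using L_index[of k j] by blast
    then consider "i = 0" | "i = 1" | "i = 2" | "i = 3" | "i = 4" | "i = 5" by linarith
    then show "P (L k z)"
      unfolding k by cases (use r in \<open>simp_all only: L_2 L_3 L_4 L_5 add_0_right\<close>)
  qed
qed

lemma L_rotate: "L (k + 1) (zeta * z) = L k z"
proof -
  have "zeta * z * cnj (eta * zeta ^ (k + 1)) = (zeta * cnj zeta) * (z * cnj (eta * zeta ^ k))"
    by (simp add: algebra_simps)
  then show ?thesis by (simp only: L_def zeta_cnj mult_1)
qed

lemma L_rotate_power: "L (k + m) (zeta ^ m * z) = L k z"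
proof (induction m)
  case (Suc m)
  then show ?case using L_rotate[of "k + m" "zeta ^ m * z"] by (simp add: algebra_simps)
qed simp

lemma norm_L: "(cmod z)\<^sup>2 = (L k z)\<^sup>2 - L k z * L (k + 1) z + (L (k + 1) z)\<^sup>2"
proof (induction k)
  case 0
  show ?case
    unfolding cmod_power2 add_0 L_0 L_1 by (simp add: power2_eq_square field_simps)
next
  case (Suc k)
  moreover have "L (Suc k + 1) z = L (Suc k) z - L k z" using L_2[of k z] by simp
  ultimately show ?case by (simp only: Suc_eq_plus1) (simp add: power2_eq_square algebra_simps)
qed

lemma L_eq_zero: "L k z = 0 \<Longrightarrow> L (k + 1) z = 0 \<Longrightarrow> z = 0"
  using norm_L[of z k] by simp

lemma L_inj: "L k z = L k w \<Longrightarrow> L (k + 1) z = L (k + 1) w \<Longrightarrow> z = w"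
  using L_eq_zero[of k "z - w"] by (simp add: L_diff)

text \<open>Conjugation sends the direction eta zeta^k to eta zeta^(-k-1), and -k - 1 is 5 * k + 5
  modulo 6.\<close>

lemma L_cnj: "L k (cnj z) = L (5 * k + 5) z"
proof -
  have "cnj zeta = zeta ^ 5"
  proof -
    have "cnj zeta = zeta ^ 6 * cnj zeta" by (simp add: zeta_power_6)
    also have "\<dots> = zeta ^ 5 * (zeta * cnj zeta)" by (simp add: eval_nat_numeral)
    finally show ?thesis by (simp add: zeta_cnj)
  qed
  then have z5: "cnj (zeta ^ 5) = zeta" by (metis complex_cnj_cnj complex_cnj_power)
  have "cnj (zeta ^ (5 * k + 5)) = zeta ^ k * zeta"
    using z5 by (simp add: power_add power_mult)
  moreover have "cnj eta * zeta = eta" by (simp add: complex_eq_iff zeta_sel eta_sel)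
  ultimately have *: "cnj (eta * zeta ^ (5 * k + 5)) = eta * zeta ^ k"
    by (simp only: complex_cnj_mult) (simp add: ac_simps)
  have "Re (cnj z * cnj (eta * zeta ^ k)) = Re (z * (eta * zeta ^ k))"
    by (simp only: complex_cnj_mult[symmetric] cnj.sel(1))
  then show ?thesis by (simp only: L_def *)
qed

lemma L_inverse: "L k (inverse w) = L (5 * k + 5) w / (cmod w)\<^sup>2"
proof -
  have "inverse w = of_real (1 / (cmod w)\<^sup>2) * cnj w"
    by (simp add: complex_eq_iff cmod_power2)
  then show ?thesis by (simp only: L_of_real L_cnj) simp
qed

lemma L_conj_index: "L (5 * (5 * k + 5) + 5) = L k"
proof (rule L_cong)
  have "5 * (5 * k + 5) + 5 = k + 6 * (4 * k + 5)" by simp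
  then show "(5 * (5 * k + 5) + 5) mod 6 = k mod 6" by (simp only: mod_mult_self2)
qed

text \<open>The two conditions describe the closed sector between zeta^j and zeta^(j+1);
  \<open>sector_rep\<close> reads the same two numbers as coordinates in that basis.\<close>

lemma sector: "\<exists>j<6. 0 \<le> L (j + 1) z \<and> 0 \<le> L (j + 5) z"
proof (rule ccontr)
  assume "\<not> ?thesis"
  then have *: "\<not> (0 \<le> L (j + 1) z \<and> 0 \<le> L (j + 5) z)" if "j < 6" for j using that by blast
  have v: "L 2 z = L 1 z - L 0 z" "L 3 z = - L 0 z" "L 4 z = - L 1 z" "L 5 z = L 0 z - L 1 z" "L 6 z = L 0 z"
    using L_2[of 0 z] L_3[of 0 z] L_4[of 0 z] L_5[of 0 z] L_6[of 0 z] by (simp_all only: add_0)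
  have v': "L 7 = L 1" "L 8 = L 2" "L 9 = L 3" "L 10 = L 4"
    by (rule L_cong, simp)+
  from *[of 0] *[of 1] *[of 2] *[of 3] *[of 4] *[of 5] show False
    by (simp add: v v' v(1)[unfolded numeral_2_eq_2]) (smt (verit))
qed

lemma L_vertex:
  "L j (zeta ^ j) = 1" "L (j + 1) (zeta ^ j) = 0" "L (j + 5) (zeta ^ j) = 1"
proof -
  have 0: "L 0 1 = 1" "L 1 1 = 0"
    unfolding L_0 L_1 by simp_all
  show "L j (zeta ^ j) = 1"
    using L_rotate_power[of 0 j 1] 0 by simp
  show 1: "L (j + 1) (zeta ^ j) = 0"
    using L_rotate_power[of 1 j 1] unfolding 0 add.commute[of 1 j] mult_1_right .
  show "L (j + 5) (zeta ^ j) = 1"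
    unfolding L_5 1 \<open>L j (zeta ^ j) = 1\<close> by simp
qed

lemma sector_rep: "z = of_real (L (j + 5) z) * zeta ^ j + of_real (L (j + 1) z) * zeta ^ (j + 1)"
    (is "z = ?w")
proof (rule L_inj)
  have "L (j + 6) (zeta ^ (j + 1)) = 1"
    using L_vertex(3)[of "j + 1"] by (simp only: add.assoc) simp
  then have *: "L j (zeta ^ (j + 1)) = 1"
    unfolding L_6 .
  show "L j z = L j ?w"
    unfolding L_add L_of_real * L_vertex L_5 by simp
  show "L (j + 1) z = L (j + 1) ?w"
    unfolding L_add L_of_real L_vertex by simp
qed

section \<open>The hexagon and its translates\<close>

lemma L_vertex_le: "L k (zeta ^ j) \<le> 1"
proof -
  have "\<forall>k. L k (zeta ^ j) \<le> 1"
    unfolding L_all[where P = "\<lambda>x. x \<le> 1" and j = j] L_vertex by simp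
  then show ?thesis by blast
qed

lemma zeta_power_mod: "zeta ^ (k mod 6) = zeta ^ k"
proof -
  have "zeta ^ k = zeta ^ (6 * (k div 6) + k mod 6)" by simp
  also have "\<dots> = zeta ^ (k mod 6)" by (simp only: power_add power_mult zeta_power_6) simp
  finally show ?thesis ..
qed

lemma zeta_vertices: "{zeta ^ k | k. k \<le> 5} = range (\<lambda>k. zeta ^ k)"
proof -
  have "zeta ^ k \<in> {zeta ^ k | k. k \<le> 5}" for k
  proof -
    have "k mod 6 \<le> 5" using mod_less_divisor[of 6 k] by linarith
    then show ?thesis using zeta_power_mod[of k] by (metis (mono_tags, lifting) mem_Collect_eq)
  qed
  then show ?thesis by blast
qed

definition closed_hexagon :: "complex set" where
  "closed_hexagon = {z. \<forall>k. L k z \<le> 1}"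

lemma closed_hexagon_Inter: "closed_hexagon = (\<Inter>k<6. {z. L k z \<le> 1})"
proof -
  have "L k z \<le> 1" if "\<forall>j<6. L j z \<le> 1" for k z
    using that[rule_format, of "k mod 6"] by (simp add: L_mod)
  then show ?thesis by (auto simp: closed_hexagon_def)
qed

lemma convex_closed_hexagon: "convex closed_hexagon"
  unfolding closed_hexagon_Inter L_inner by (intro convex_INT convex_halfspace_le)

text \<open>In its sector a point has nonnegative coordinates with sum \<open>L j z\<close>, which
  is at most 1. It is therefore a convex combination of two adjacent vertices and the
  centre.\<close>

lemma convex_hull_hexagon: "convex hull {zeta ^ k | k. k \<le> 5} = closed_hexagon"
proof
  show "convex hull {zeta ^ k | k. k \<le> 5} \<subseteq> closed_hexagon"
    unfolding zeta_vertices
    by (intro hull_minimal convex_closed_hexagon) (auto simp: closed_hexagon_def L_vertex_le)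
next
  let ?H = "convex hull {zeta ^ k | k. k \<le> 5}"
  have v: "zeta ^ k \<in> ?H" for k
    unfolding zeta_vertices by (rule hull_inc) simp
  have H: "convex ?H" by (rule convex_convex_hull)
  have "(1 / 2) *\<^sub>R zeta ^ 3 + (1 / 2) *\<^sub>R zeta ^ 0 \<in> ?H"
    by (intro convexD[OF H] v) auto
  then have 0: "0 \<in> ?H" by (simp add: zeta_power_3)
  show "closed_hexagon \<subseteq> ?H"
  proof
    fix z assume z: "z \<in> closed_hexagon"
    obtain j where j: "0 \<le> L (j + 1) z" "0 \<le> L (j + 5) z" using sector[of z] by blast
    have "L j z \<le> 1" using z by (simp add: closed_hexagon_def)
    then have s: "L (j + 5) z + L (j + 1) z \<le> 1" using L_5[of j z] by linarith
    show "z \<in> ?H"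
    proof (cases "L (j + 5) z + L (j + 1) z = 0")
      case True
      with j have "L (j + 5) z = 0" "L (j + 1) z = 0" by linarith+
      with sector_rep[of z j] have "z = 0" by (simp only: of_real_0) simp
      with 0 show ?thesis by simp
    next
      case False
      define t where "t = L (j + 5) z + L (j + 1) z"
      with False j s have t: "0 < t" "t \<le> 1" by linarith+
      have c: "(L (j + 5) z / t) *\<^sub>R zeta ^ j + (L (j + 1) z / t) *\<^sub>R zeta ^ (j + 1) \<in> ?H"
        using j t by (intro convexD[OF H] v) (auto simp: t_def simp flip: add_divide_distrib)
      then have "t *\<^sub>R ((L (j + 5) z / t) *\<^sub>R zeta ^ j + (L (j + 1) z / t) *\<^sub>R zeta ^ (j + 1)) + (1 - t) *\<^sub>R 0 \<in> ?H"
        using t by (intro convexD[OF H c 0]) linarith+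
      also have "t *\<^sub>R ((L (j + 5) z / t) *\<^sub>R zeta ^ j + (L (j + 1) z / t) *\<^sub>R zeta ^ (j + 1)) + (1 - t) *\<^sub>R 0
          = of_real (L (j + 5) z) * zeta ^ j + of_real (L (j + 1) z) * zeta ^ (j + 1)"
        using t by (simp add: scaleR_add_right) (simp add: scaleR_conv_of_real)
      also have "\<dots> = z" using sector_rep[of z j] by (rule sym)
      finally show ?thesis .
    qed
  qed
qed

lemma interior_L_le: "interior {z. L k z \<le> c} = {z. L k z < c}"
  unfolding L_inner by (rule interior_halfspace_le[OF L_normal_nonzero])

lemma interior_closed_hexagon: "interior closed_hexagon = {z. \<forall>k. L k z < 1}"
proof
  have "interior closed_hexagon \<subseteq> {z. L k z < 1}" for k
    unfolding interior_L_le[symmetric] by (rule interior_mono) (auto simp: closed_hexagon_def)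
  then show "interior closed_hexagon \<subseteq> {z. \<forall>k. L k z < 1}" by blast
next
  have "L k z < 1" if "\<forall>j<6. L j z < 1" for k z
    using that[rule_format, of "k mod 6"] by (simp add: L_mod)
  then have eq: "{z. \<forall>k. L k z < 1} = (\<Inter>k<6. {z. L k z < 1})" by auto
  show "{z. \<forall>k. L k z < 1} \<subseteq> interior closed_hexagon"
  proof (rule interior_maximal)
    show "{z. \<forall>k. L k z < 1} \<subseteq> closed_hexagon"
      by (auto simp: closed_hexagon_def less_imp_le)
    show "open {z. \<forall>k. L k z < 1}"
      unfolding eq interior_L_le[symmetric] by (intro open_INT) auto
  qed
qed

lemma U_subset: "U \<subseteq> closed_hexagon"
proof -
  have v: "zeta ^ k \<in> closed_hexagon" for k by (simp add: closed_hexagon_def L_vertex_le)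
  have eq: "1 = zeta ^ 0" "zeta = zeta ^ 1" "- cnj zeta = zeta ^ 2" "- 1 = zeta ^ 3" "- zeta = zeta ^ 4" "cnj zeta = zeta ^ 5"
  proof -
    show 2: "- cnj zeta = zeta ^ 2"
      unfolding power2_eq_square zeta_square by (simp add: complex_eq_iff zeta_sel)
    have "zeta ^ 4 = zeta ^ 3 * zeta" "zeta ^ 5 = zeta ^ 3 * zeta ^ 2" by (simp_all add: eval_nat_numeral)
    then show "- zeta = zeta ^ 4" "cnj zeta = zeta ^ 5" by (simp_all add: zeta_power_3 flip: 2)
  qed (simp_all add: zeta_power_3)
  have vs: "1 \<in> closed_hexagon" "zeta \<in> closed_hexagon" "- cnj zeta \<in> closed_hexagon" "- 1 \<in> closed_hexagon"
     "- zeta \<in> closed_hexagon" "cnj zeta \<in> closed_hexagon"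
    using v[of 0] v[of 1] v[of 2] v[of 3] v[of 4] v[of 5] unfolding eq[symmetric] by auto
  have "open_segment a b \<subseteq> closed_hexagon" if "a \<in> closed_hexagon" "b \<in> closed_hexagon" for a b
    using closed_segment_subset[OF that convex_closed_hexagon] segment_open_subset_closed by blast
  moreover have "open_hexagon \<subseteq> closed_hexagon"
    unfolding open_hexagon_def convex_hull_hexagon by (rule interior_subset)
  ultimately show ?thesis
    unfolding U_def using vs by auto
qed

lemma U0_eq: "U0 = {z. \<forall>k. L k z < 1}"
proof -
  have "interior closed_hexagon \<subseteq> U"
    unfolding U_def open_hexagon_def convex_hull_hexagon by blast
  then have "interior U = interior closed_hexagon"
    by (metis U_subset interior_mono interior_maximal open_interior subset_antisym)
  then show ?thesis by (simp add: U0_def interior_closed_hexagon)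
qed

lemma U0_subset_U: "U0 \<subseteq> U"
  unfolding U0_def by (rule interior_subset)

lemma open_U0: "open U0"
  unfolding U0_def by (rule open_interior)

lemma U0_L: "u \<in> U0 \<Longrightarrow> L k u < 1"
  by (simp add: U0_eq)

lemma U0_L': "u \<in> U0 \<Longrightarrow> - 1 < L k u"
  using U0_L[of u "k + 3"] L_3[of k u] by linarith

section \<open>The lattice J and the tiling by hexagons\<close>

lemma J_L_exists: "a \<in> J \<Longrightarrow> \<exists>s t. L k a = of_int s \<and> L (k + 1) a = of_int t \<and> 3 dvd s + t"
proof (induction k)
  case 0
  then obtain m n where a: "a = eta * (of_int m + of_int n * zeta)"
    by (auto simp: J_def eisenstein_ints_def)
  have "L 0 a = of_int (2 * m + n)" "L 1 a = of_int (m + 2 * n)"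
    unfolding L_0 L_1 a by (simp_all add: zeta_sel eta_sel field_simps)
  then show ?case by (intro exI[of _ "2 * m + n"] exI[of _ "m + 2 * n"]) auto
next
  case (Suc k)
  then obtain s t where st: "L k a = of_int s" "L (k + 1) a = of_int t" "3 dvd s + t" by blast
  have "L (Suc k + 1) a = of_int (t - s)" using st L_2[of k a] by simp
  moreover have "3 dvd t + (t - s)" using st(3) by presburger
  ultimately show ?case using st by (intro exI[of _ t] exI[of _ "t - s"]) simp
qed

lemma J_exists: "3 dvd s + t \<Longrightarrow> \<exists>a\<in>J. L 0 a = of_int s \<and> L 1 a = of_int t"
proof -
  assume "3 dvd s + t"
  then obtain n' where n: "s + t = 3 * n'" by (elim dvdE)
  \<comment> \<open>These solve s = 2m + n and t = m + 2n, since then m + n = (s + t) / 3.\<close>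
  define m n where "m = s - n'" and "n = t - n'"
  let ?a = "eta * (of_int m + of_int n * zeta)"
  have "?a \<in> J" by (auto simp: J_def eisenstein_ints_def)
  moreover have "L 0 ?a = of_int (2 * m + n)" "L 1 ?a = of_int (m + 2 * n)"
    unfolding L_0 L_1 by (simp_all add: zeta_sel eta_sel field_simps)
  moreover have "2 * m + n = s" "m + 2 * n = t" using n by (simp_all add: m_def n_def)
  ultimately show ?thesis by blast
qed

lemma J_int: "a \<in> J \<Longrightarrow> \<exists>m. L k a = of_int m"
  using J_L_exists by blast

lemma countable_J: "countable J"
proof -
  have "J = (\<lambda>(m, n). eta * (of_int m + of_int n * zeta)) ` (UNIV :: (int \<times> int) set)"
    by (auto simp: J_def eisenstein_ints_def image_iff)
  then show ?thesis by (metis countable_image countableI_type)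
qed

lemma diff_J: "a \<in> J \<Longrightarrow> b \<in> J \<Longrightarrow> a - b \<in> J"
proof -
  assume "a \<in> J" "b \<in> J"
  then obtain m n m' n' where "a = eta * (of_int m + of_int n * zeta)" "b = eta * (of_int m' + of_int n' * zeta)"
    by (auto simp: J_def eisenstein_ints_def)
  then have "a - b = eta * (of_int (m - m') + of_int (n - n') * zeta)" by (simp add: algebra_simps)
  then show ?thesis unfolding J_def eisenstein_ints_def by blast
qed

text \<open>If no direction reaches 3, both coordinates and their difference lie between -2 and 2.
  Divisibility by 3 then leaves only 0 and the six points eta zeta^j.\<close>

lemma J_cases:
  assumes "a \<in> J"
  obtains "a = 0" | j where "j < 6" "L j a = 2" "L (j + 1) a = 1" | j where "j < 6" "3 \<le> L j a"
proof -
  obtain s t where st: "L 0 a = of_int s" "L 1 a = of_int t" "3 dvd s + t"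
    using J_L_exists[OF assms, of 0] by auto
  have v: "L 2 a = of_int (t - s)" "L 3 a = of_int (- s)" "L 4 a = of_int (- t)" "L 5 a = of_int (s - t)" "L 6 a = of_int s"
    using L_2[of 0 a] L_3[of 0 a] L_4[of 0 a] L_5[of 0 a] L_6[of 0 a] st by (simp_all only: add_0) (simp_all only: of_int_diff of_int_minus)?
  consider "3 \<le> s \<or> 3 \<le> t \<or> 3 \<le> t - s \<or> s \<le> -3 \<or> t \<le> -3 \<or> t - s \<le> -3"
    | "s \<in> {-2..2}" "t \<in> {-2..2}" "t - s \<in> {-2..2}" by fastforce
  then show thesis
  proof cases
    case 1
    then have "\<exists>j<6. 3 \<le> L j a"
    proof (elim disjE)
      assume "3 \<le> s" then show ?thesis by (intro exI[of _ 0]) (simp add: st)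
    next
      assume "3 \<le> t" then show ?thesis by (intro exI[of _ 1]) (simp add: st(2)[simplified])
    next
      assume "3 \<le> t - s" then show ?thesis by (intro exI[of _ 2]) (simp only: v, linarith)
    next
      assume "s \<le> -3" then show ?thesis by (intro exI[of _ 3]) (simp only: v, linarith)
    next
      assume "t \<le> -3" then show ?thesis by (intro exI[of _ 4]) (simp only: v, linarith)
    next
      assume "t - s \<le> -3" then show ?thesis by (intro exI[of _ 5]) (simp only: v, linarith)
    qed
    then show ?thesis using that(3) by blast
  next
    case 2
    then have "s \<in> {-2,-1,0,1,2}" "t \<in> {-2,-1,0,1,2}" by auto
    then have "(s, t) \<in> {(0,0),(2,1),(1,2),(-1,1),(-2,-1),(-1,-2),(1,-1)}"
      using 2 st(3) by auto
    moreover have "a = 0" if "s = 0" "t = 0" using L_eq_zero[of 0 a] st that by simp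
    ultimately show ?thesis
      using that(1) that(2)[of 0] that(2)[of 1] that(2)[of 2] that(2)[of 3] that(2)[of 4] that(2)[of 5] st v v(1)[unfolded numeral_2_eq_2]
      by auto
  qed
qed

text \<open>If the tile of b also contains a + u, then b - a has every \<open>L k\<close> below 2,
  which excludes all nonzero lattice points.\<close>

lemma nearest_add:
  assumes "a \<in> J" "u \<in> U0"
  shows "nearest (a + u) = a"
  unfolding nearest_def
proof (rule the_equality)
  show "a \<in> J \<and> a + u \<in> (\<lambda>u. a + u) ` U" using assms U0_subset_U by auto
next
  fix b assume b: "b \<in> J \<and> a + u \<in> (\<lambda>u. b + u) ` U"
  then have "a + u - b \<in> closed_hexagon" using U_subset by auto
  then have "L k (a + u - b) \<le> 1" for k by (simp add: closed_hexagon_def)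
  then have *: "L k (b - a) \<ge> L k u - 1" for k
    using \<open>\<And>k. L k (a + u - b) \<le> 1\<close>[of k] unfolding L_diff L_add by linarith
  have small: "L k (b - a) < 2" for k
    using *[of "k + 3"] U0_L'[OF assms(2), of "k + 3"] unfolding L_3 by linarith
  from diff_J[of b a] b assms(1) have "b - a \<in> J" by blast
  then show "b = a"
  proof (cases rule: J_cases)
    case (2 j)
    with small[of j] show ?thesis by simp
  next
    case (3 j)
    with small[of j] show ?thesis by simp
  qed simp
qed

text \<open>These lines contain the sides of all lattice translates of the hexagon, so off them
  every point is interior to a tile.\<close>

definition grid :: "complex set" where
  "grid = {z. \<exists>k. L k z \<in> \<int>}"

lemma negligible_L: "negligible {z. L k z = c}"
  unfolding L_inner using L_normal_nonzero by (intro negligible_hyperplane) blast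

lemma negligible_grid: "negligible grid"
proof -
  have "grid = (\<Union>k. \<Union>m. {z. L k z = of_int m})"
    by (auto simp: grid_def Ints_def)
  also have "negligible \<dots>"
    by (intro negligible_countable_Union) (auto intro: negligible_countable_Union negligible_L)
  finally show ?thesis .
qed

lemma tiling:
  assumes "z \<notin> grid"
  obtains a u where "a \<in> J" "u \<in> U0" "z = a + u"
proof -
  note tile = that
  define m n where "m = \<lfloor>L 0 z\<rfloor>" and "n = \<lfloor>L 1 z\<rfloor>"
  have ni: "L k z \<notin> \<int>" for k using assms by (auto simp: grid_def)
  define p q where "p = L 0 z - m" and "q = L 1 z - n"
  have "of_int m \<noteq> L 0 z" "of_int n \<noteq> L 1 z" using ni[of 0] ni[of 1] Ints_of_int by metis+
  then have pq: "0 < p" "p < 1" "0 < q" "q < 1"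
    unfolding p_def q_def m_def n_def by linarith+
  have "L 2 z = of_int (n - m) + q - p" using L_2[of 0 z] unfolding add_0 p_def q_def by simp
  then have "p \<noteq> q" using ni[of 2] by auto
  have key: thesis if st: "3 dvd s + t" "\<bar>L 0 z - of_int s\<bar> < 1" "\<bar>L 1 z - of_int t\<bar> < 1"
    "\<bar>(L 1 z - of_int t) - (L 0 z - of_int s)\<bar> < 1" for s t
  proof -
    obtain a where a: "a \<in> J" "L 0 a = of_int s" "L 1 a = of_int t" using J_exists[OF st(1)] by blast
    have "\<forall>k. L k (z - a) < 1"
      using st unfolding L_all[where P = "\<lambda>x. x < 1" and j = 0 and z = "z - a"]
      unfolding add_0 L_diff a by linarith
    then show thesis using \<open>a \<in> J\<close> by (intro tile[of a "z - a"]) (auto simp: U0_eq)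
  qed
  have z: "L 0 z = m + p" "L 1 z = n + q" by (simp_all add: p_def q_def)
  \<comment> \<open>The residue of m + n modulo 3 decides which corners of the unit cell around z
    are lattice points. In the third case both mixed corners are, and the diagonal p = q separates
    their tiles.\<close>
  have "3 dvd m + n \<or> 3 dvd (m + 1) + (n + 1) \<or> 3 dvd (m + 1) + n" by presburger
  then consider "3 dvd m + n" | "3 dvd (m + 1) + (n + 1)" | "3 dvd (m + 1) + n" by blast
  then show thesis
  proof cases
    case 1
    then show thesis by (rule key) (use pq z in \<open>simp_all add: abs_less_iff\<close>)
  next
    case 2
    then show thesis by (rule key) (use pq z in \<open>simp_all add: abs_less_iff\<close>)
  next
    case 3
    show thesis
    proof (cases "q < p")
      case True
      show thesis by (rule key[OF 3]) (use pq z True in \<open>simp_all add: abs_less_iff\<close>)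
    next
      case False
      with \<open>p \<noteq> q\<close> have "p < q" by simp
      from 3 have "3 dvd m + (n + 1)" by (simp add: ac_simps)
      then show thesis by (rule key) (use pq z \<open>p < q\<close> in \<open>simp_all add: abs_less_iff\<close>)
    qed
  qed
qed

section \<open>A finite family of regions stable under the map\<close>

text \<open>The circles here and in \<open>inner_cut\<close> have radius \<open>rad\<close> and
  centres -2/3 eta zeta^j and -1/3 eta zeta^j. Both pass through the two vertices on the side
  \<open>L j z = -1\<close>, and the inner one also through 0.\<close>

definition outer_cut :: "nat \<Rightarrow> complex set" where
  "outer_cut j = {z \<in> U0. 0 < (cmod z)\<^sup>2 + 2 * L j z + 1}"

definition inner_cut :: "nat \<Rightarrow> complex set" where
  "inner_cut j = {z \<in> U0. 0 < (cmod z)\<^sup>2 + L j z}"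

definition half_cut :: "nat \<Rightarrow> complex set" where
  "half_cut j = {z \<in> U0. 0 < L j z}"

definition regions :: "complex set set" where
  "regions = {{}, U0} \<union> range outer_cut \<union> range inner_cut \<union> range half_cut \<union>
     range (\<lambda>j. outer_cut j \<inter> half_cut (j + 2)) \<union> range (\<lambda>j. outer_cut j \<inter> half_cut (j + 4))"

lemma regions_intros:
  "{} \<in> regions" "U0 \<in> regions" "outer_cut j \<in> regions" "inner_cut j \<in> regions" "half_cut j \<in> regions"
  "outer_cut j \<inter> half_cut (j + 2) \<in> regions" "outer_cut j \<inter> half_cut (j + 4) \<in> regions"
  unfolding regions_def by blast+

lemma regions_cases:
  assumes "G \<in> regions"
  obtains "G = {}" | "G = U0" | k where "G = outer_cut k" | k where "G = inner_cut k" | k where "G = half_cut k"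
    | k i where "G = outer_cut k \<inter> half_cut (k + i)" "i = 2 \<or> i = 4"
  using assms unfolding regions_def by blast

lemma L_cong_sets:
  assumes "L j = L k"
  shows "outer_cut j = outer_cut k" "inner_cut j = inner_cut k" "half_cut j = half_cut k"
  using assms by (simp_all add: outer_cut_def inner_cut_def half_cut_def)

lemma finite_regions: "finite regions"
proof -
  have fin: "finite (range f)" if "\<And>j. f j = f (j mod 6)" for f :: "nat \<Rightarrow> complex set"
  proof (rule finite_subset)
    show "range f \<subseteq> f ` {..<6}"
    proof
      fix x assume "x \<in> range f"
      then obtain j where "x = f j" by blast
      also have "\<dots> = f (j mod 6)" by (rule that)
      finally show "x \<in> f ` {..<6}" by simp
    qed
  qed simp
  have *: "L (j mod 6 + i) = L (j + i)" for i j
    by (rule L_cong) (simp add: mod_simps)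
  note c = L_cong_sets[OF L_mod] L_cong_sets[OF *]
  have "finite (range outer_cut)" "finite (range inner_cut)" "finite (range half_cut)"
    "finite (range (\<lambda>j. outer_cut j \<inter> half_cut (j + 2)))" "finite (range (\<lambda>j. outer_cut j \<inter> half_cut (j + 4)))"
    by (rule fin, simp only: c)+
  then show ?thesis by (simp add: regions_def)
qed

section \<open>Circles in hexagonal coordinates and regular open sets\<close>

lemma norm_add_center: "(cmod (z + of_real c * (eta * zeta ^ j)))\<^sup>2 = (cmod z)\<^sup>2 + 3 * c * L j z + 3 * c\<^sup>2"
proof -
  define v where "v = eta * zeta ^ j"
  have "(cmod eta)\<^sup>2 = 3" unfolding cmod_power2 eta_sel by (simp add: power2_eq_square)
  then have v: "(cmod v)\<^sup>2 = 3" by (simp add: v_def norm_mult norm_power)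
  have "(cmod (z + of_real c * v))\<^sup>2 = (cmod z)\<^sup>2 + 2 * c * Re (z * cnj v) + c\<^sup>2 * (cmod v)\<^sup>2"
    unfolding cmod_power2 by (simp add: power2_eq_square algebra_simps)
  then show ?thesis unfolding v by (simp add: L_def v_def)
qed

lemma rad_square: "rad\<^sup>2 = 1 / 3" and rad_pos: "0 < rad"
  by (simp_all add: rad_def power2_eq_square)

lemma rad_less_iff: "rad < cmod z \<longleftrightarrow> 1 / 3 < (cmod z)\<^sup>2"
  and less_rad_iff: "cmod z < rad \<longleftrightarrow> (cmod z)\<^sup>2 < 1 / 3"
  using rad_pos abs_le_square_iff[of "cmod z" rad] abs_le_square_iff[of rad "cmod z"]
  by (auto simp: rad_square not_le[symmetric])

lemma outer_disc_iff: "rad < cmod (z + 2 / 3 * (eta * zeta ^ j)) \<longleftrightarrow> 0 < (cmod z)\<^sup>2 + 2 * L j z + 1"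
  and inner_disc_iff: "rad < cmod (z + 1 / 3 * (eta * zeta ^ j)) \<longleftrightarrow> 0 < (cmod z)\<^sup>2 + L j z"
  and outer_disc_le: "cmod (z + 2 / 3 * (eta * zeta ^ j)) < rad \<longleftrightarrow> (cmod z)\<^sup>2 + 2 * L j z + 1 < 0"
  and inner_disc_le: "cmod (z + 1 / 3 * (eta * zeta ^ j)) < rad \<longleftrightarrow> (cmod z)\<^sup>2 + L j z < 0"
  using norm_add_center[of z "2 / 3" j] norm_add_center[of z "1 / 3" j]
  by (simp_all add: rad_less_iff less_rad_iff power2_eq_square) argo+

lemma interior_outside_disc: "interior {z. rad \<le> cmod (z + c)} = {z. rad < cmod (z + c)}"
proof -
  have "{z. rad \<le> cmod (z + c)} = - ball (- c) rad" "{z. rad < cmod (z + c)} = - cball (- c) rad"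
    by (auto simp: dist_norm norm_minus_commute[of "- c"])
  then show ?thesis using rad_pos by (simp add: interior_complement)
qed

lemma interior_L_ge: "interior {z. 0 \<le> L j z} = {z. 0 < L j z}"
  using interior_L_le[of "j + 3" 0] unfolding L_3 by simp

lemma closed_closed_hexagon: "closed closed_hexagon"
  unfolding closed_hexagon_Inter L_inner by (intro closed_INT ballI closed_halfspace_le)

lemma regular_halfplane: "closed {z. 0 \<le> L j z}" "open {z. 0 < L j z}"
  unfolding L_inner by (simp_all only: closed_halfspace_ge open_halfspace_gt)

lemma regular_disc: "closed {z. rad \<le> cmod (z + c)}" "open {z. rad < cmod (z + c)}"
  by (intro closed_Collect_le open_Collect_less continuous_intros)+

text \<open>This is regularity of an open set, phrased with an arbitrary closed witness so that it
  passes to intersections at once.\<close>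

definition regular :: "complex set \<Rightarrow> bool" where
  "regular G \<longleftrightarrow> open G \<and> (\<exists>K. closed K \<and> G \<subseteq> K \<and> interior K \<subseteq> G)"

lemma regular_Int: "regular G \<Longrightarrow> regular H \<Longrightarrow> regular (G \<inter> H)"
proof -
  assume "regular G" "regular H"
  then obtain K M where "open G" "open H" "closed K" "G \<subseteq> K" "interior K \<subseteq> G" "closed M" "H \<subseteq> M" "interior M \<subseteq> H"
    unfolding regular_def by blast
  then show ?thesis unfolding regular_def
    by (intro conjI exI[of _ "K \<inter> M"]) (auto simp: interior_Int)
qed

lemma regular_U0: "regular U0"
  unfolding regular_def using closed_closed_hexagon open_U0 interior_closed_hexagon
  by (intro conjI exI[of _ closed_hexagon]) (auto simp: U0_eq closed_hexagon_def less_imp_le)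

lemma regular_outer_cut: "regular (outer_cut j)" and regular_inner_cut: "regular (inner_cut j)" and regular_half_cut: "regular (half_cut j)"
proof -
  have disc: "regular {z. rad < cmod (z + c)}" for c
    unfolding regular_def using regular_disc[of c] interior_outside_disc[of c]
    by (intro conjI exI[of _ "{z. rad \<le> cmod (z + c)}"]) auto
  have half: "regular {z. 0 < L j z}"
    unfolding regular_def using regular_halfplane[of j] interior_L_ge[of j]
    by (intro conjI exI[of _ "{z. 0 \<le> L j z}"]) auto
  have "outer_cut j = U0 \<inter> {z. rad < cmod (z + 2 / 3 * (eta * zeta ^ j))}"
    "inner_cut j = U0 \<inter> {z. rad < cmod (z + 1 / 3 * (eta * zeta ^ j))}"
    "half_cut j = U0 \<inter> {z. 0 < L j z}"
    unfolding outer_disc_iff inner_disc_iff by (auto simp: outer_cut_def inner_cut_def half_cut_def)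
  then show "regular (outer_cut j)" "regular (inner_cut j)" "regular (half_cut j)"
    using regular_Int[OF regular_U0 disc] regular_Int[OF regular_U0 half] by simp_all
qed

lemma regular_regions: "G \<in> regions \<Longrightarrow> regular G"
  unfolding regions_def
  by (auto intro: regular_U0 regular_outer_cut regular_inner_cut regular_half_cut regular_Int) (simp add: regular_def exI[of _ "{}"])

lemma regions_subset: "G \<in> regions \<Longrightarrow> G \<subseteq> U0"
  by (auto simp: regions_def outer_cut_def inner_cut_def half_cut_def)

section \<open>Pulling a region back through one digit\<close>

definition pull :: "complex \<Rightarrow> complex set \<Rightarrow> complex set" where
  "pull a G = {u \<in> U0. u + a \<noteq> 0 \<and> inverse (u + a) \<in> G}"

lemma pull_Int: "pull a (G \<inter> H) = pull a G \<inter> pull a H"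
  and pull_mono: "G \<subseteq> H \<Longrightarrow> pull a G \<subseteq> pull a H"
  and pull_empty [simp]: "pull a {} = {}"
  and pull_subset: "pull a G \<subseteq> U0"
  by (auto simp: pull_def)

text \<open>Each side line inverts to a circle through 0. The conjugation of indices is an
  involution, so quantifying over all k removes it.\<close>

lemma inverse_U0_iff: "w \<noteq> 0 \<Longrightarrow> inverse w \<in> U0 \<longleftrightarrow> (\<forall>k. L k w < (cmod w)\<^sup>2)"
proof -
  assume w: "w \<noteq> 0"
  have "inverse w \<in> U0 \<longleftrightarrow> (\<forall>k. L (5 * k + 5) w < (cmod w)\<^sup>2)"
    using w by (simp add: U0_eq L_inverse divide_less_eq)
  also have "\<dots> \<longleftrightarrow> (\<forall>k. L k w < (cmod w)\<^sup>2)"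
    using L_conj_index by metis
  finally show ?thesis .
qed

lemma pull_U0: "pull a U0 = {u \<in> U0. u + a \<noteq> 0 \<and> (\<forall>k. L k (u + a) < (cmod (u + a))\<^sup>2)}"
  by (auto simp: pull_def inverse_U0_iff)

text \<open>The constant term 1 is the power of 0 with respect to the circle, so inversion only
  conjugates it.\<close>

lemma pull_outer_cut: "pull a (outer_cut k) = {u \<in> pull a U0. 0 < (cmod (u + a))\<^sup>2 + 2 * L (5 * k + 5) (u + a) + 1}"
proof -
  have "0 < (cmod (inverse w))\<^sup>2 + 2 * L k (inverse w) + 1 \<longleftrightarrow> 0 < (cmod w)\<^sup>2 + 2 * L (5 * k + 5) w + 1"
    if "w \<noteq> 0" for w
  proof -
    have "(cmod (inverse w))\<^sup>2 + 2 * L k (inverse w) + 1 = ((cmod w)\<^sup>2 + 2 * L (5 * k + 5) w + 1) / (cmod w)\<^sup>2"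
      using that unfolding L_inverse norm_inverse by (simp add: field_simps)
    then show ?thesis using that by (simp add: zero_less_divide_iff)
  qed
  then show ?thesis by (auto simp: pull_def outer_cut_def)
qed

text \<open>The circle passes through 0, so inversion straightens it to a side line.\<close>

lemma pull_inner_cut: "pull a (inner_cut k) = {u \<in> pull a U0. 0 < L (5 * k + 5) (u + a) + 1}"
proof -
  have "0 < (cmod (inverse w))\<^sup>2 + L k (inverse w) \<longleftrightarrow> 0 < L (5 * k + 5) w + 1"
    if "w \<noteq> 0" for w
  proof -
    have "(cmod (inverse w))\<^sup>2 + L k (inverse w) = (L (5 * k + 5) w + 1) / (cmod w)\<^sup>2"
      using that unfolding L_inverse norm_inverse by (simp add: field_simps)
    then show ?thesis using that by (simp add: zero_less_divide_iff)
  qed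
  then show ?thesis by (auto simp: pull_def inner_cut_def)
qed

lemma pull_half_cut: "pull a (half_cut k) = {u \<in> pull a U0. 0 < L (5 * k + 5) (u + a)}"
  by (auto simp: pull_def half_cut_def L_inverse zero_less_divide_iff)

text \<open>On the hexagon \<open>L k\<close> stays strictly between -1 and 1, and the shift by a
  and m is an integer. The line can therefore meet the hexagon only when that integer is 0, and then
  it is a diagonal.\<close>

lemma half_plane_cases:
  assumes "a \<in> J" "X \<subseteq> U0"
  shows "{u \<in> X. 0 < L k (u + a) + of_int m} \<in> {X, {}, X \<inter> half_cut k}"
    and "0 < L k a + of_int m \<Longrightarrow> {u \<in> X. 0 < L k (u + a) + of_int m} = X"
    and "L k a + of_int m < 0 \<Longrightarrow> {u \<in> X. 0 < L k (u + a) + of_int m} = {}"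
    and "L k a + of_int m = 0 \<Longrightarrow> {u \<in> X. 0 < L k (u + a) + of_int m} = X \<inter> half_cut k"
proof -
  obtain s where s: "L k a + of_int m = of_int s" using J_int[OF assms(1), of k] by (metis of_int_add)
  have e: "L k (u + a) + of_int m = L k u + of_int s" for u using s by (simp add: L_add)
  have b: "- 1 < L k u" "L k u < 1" if "u \<in> X" for u using that assms(2) U0_L U0_L' by blast+
  have 1: "{u \<in> X. 0 < L k (u + a) + of_int m} = X" if "0 < s"
  proof -
    have "(1::real) \<le> of_int s" using that by simp
    then show ?thesis unfolding e using b by force
  qed
  moreover have 2: "{u \<in> X. 0 < L k (u + a) + of_int m} = {}" if "s < 0"
  proof -
    have "of_int s \<le> (-1::real)" using that by simp
    then show ?thesis unfolding e using b by force
  qed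
  moreover have 3: "{u \<in> X. 0 < L k (u + a) + of_int m} = X \<inter> half_cut k" if "s = 0"
    unfolding e that half_cut_def using assms(2) by auto
  ultimately show "{u \<in> X. 0 < L k (u + a) + of_int m} \<in> {X, {}, X \<inter> half_cut k}"
    by (cases s "0 :: int" rule: linorder_cases) blast+
  show "0 < L k a + of_int m \<Longrightarrow> {u \<in> X. 0 < L k (u + a) + of_int m} = X"
    "L k a + of_int m < 0 \<Longrightarrow> {u \<in> X. 0 < L k (u + a) + of_int m} = {}"
    "L k a + of_int m = 0 \<Longrightarrow> {u \<in> X. 0 < L k (u + a) + of_int m} = X \<inter> half_cut k"
    using 1 2 3 unfolding s by simp_all
qed

lemma norm_ge_L: "3 / 4 * (L k z)\<^sup>2 \<le> (cmod z)\<^sup>2"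
proof -
  have "(cmod z)\<^sup>2 - 3 / 4 * (L k z)\<^sup>2 = (L (k + 1) z - L k z / 2)\<^sup>2"
    unfolding norm_L[of z k] by (simp add: power2_eq_square field_simps)
  then show ?thesis by (metis diff_ge_0_iff_ge zero_le_power2)
qed

text \<open>The hypothesis gives |w|^2 > 3. Small values of \<open>L k w\<close> are handled by this
  bound, large ones by the quadratic bound \<open>norm_ge_L\<close>.\<close>

lemma far_bounds:
  assumes "2 < L j w"
  shows "L k w < (cmod w)\<^sup>2" "0 < (cmod w)\<^sup>2 + 2 * L k w + 1"
proof -
  have "2 * 2 < L j w * L j w" using assms by (intro mult_strict_mono) auto
  then have N: "3 < (cmod w)\<^sup>2" using norm_ge_L[of j w] by (simp add: power2_eq_square)
  have k: "3 / 4 * (L k w * L k w) \<le> (cmod w)\<^sup>2" using norm_ge_L[of k w] by (simp add: power2_eq_square)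
  show "L k w < (cmod w)\<^sup>2"
  proof (cases "L k w \<le> 3")
    case False
    then have "3 * L k w < L k w * L k w" by (intro mult_strict_right_mono) auto
    with k False show ?thesis by linarith
  qed (use N in linarith)
  show "0 < (cmod w)\<^sup>2 + 2 * L k w + 1"
  proof (cases "L k w < - 2")
    case True
    \<comment> \<open>With x = \<open>L k w\<close>, three quarters of this product is 3/4 x^2 + 2 x
      + 1, a lower bound for the target.\<close>
    then have "0 < (L k w + 2) * (L k w + 2 / 3)" by (intro mult_neg_neg) auto
    then have "0 < L k w * L k w + 8 / 3 * L k w + 4 / 3" by (simp add: field_simps)
    with k show ?thesis by linarith
  qed (use N in linarith)
qed

lemma norm_U0: "u \<in> U0 \<Longrightarrow> (cmod u)\<^sup>2 < 1"
proof -
  assume u: "u \<in> U0"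
  obtain j where j: "0 \<le> L (j + 1) u" "0 \<le> L (j + 5) u" using sector by blast
  have p: "L j u = L (j + 5) u + L (j + 1) u" using L_5[of j u] by simp
  have "0 \<le> L (j + 1) u * L (j + 5) u" using j by simp
  then have "(cmod u)\<^sup>2 \<le> (L j u)\<^sup>2"
    unfolding norm_L[of u j] p by (simp add: power2_eq_square algebra_simps)
  moreover have "(L j u)\<^sup>2 < 1" using U0_L[OF u, of j] j p by (simp add: abs_square_less_1)
  ultimately show ?thesis by linarith
qed

text \<open>The open hexagon lies in the open unit disc, which cannot contain both u and
  1/u.\<close>

lemma pull_zero: "pull 0 U0 = {}"
proof -
  have "u = 0" if "u \<in> U0" "inverse u \<in> U0" for u
  proof (rule ccontr)
    assume "u \<noteq> 0"
    then have "(cmod u)\<^sup>2 * (cmod (inverse u))\<^sup>2 = 1" by (simp add: norm_inverse flip: power_mult_distrib)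
    moreover have "(cmod u)\<^sup>2 * (cmod (inverse u))\<^sup>2 < 1"
      using norm_U0[OF that(1)] norm_U0[OF that(2)] mult_strict_mono[of "(cmod u)\<^sup>2" 1 "(cmod (inverse u))\<^sup>2" 1] by simp
    ultimately show False by simp
  qed
  then show ?thesis by (auto simp: pull_def)
qed

lemma pull_far:
  assumes "a \<in> J" "3 \<le> L j a"
  shows "pull a U0 = U0" "pull a (outer_cut k) = U0"
proof -
  have far: "2 < L j (u + a)" if "u \<in> U0" for u
    using U0_L'[OF that, of j] assms(2) by (simp add: L_add)
  have "u + a \<noteq> 0" if "u \<in> U0" for u using far[OF that] by auto
  then show "pull a U0 = U0" using far_bounds(1)[OF far] by (auto simp: pull_U0)
  then show "pull a (outer_cut k) = U0" using far_bounds(2)[OF far] by (auto simp: pull_outer_cut)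
qed

context
  fixes j a
  assumes a: "L j a = 2" "L (j + 1) a = 1"
begin

lemma norm_neighbour: "(cmod (u + a))\<^sup>2 = (cmod u)\<^sup>2 + 3 * L j u + 3"
  unfolding norm_L[of _ j] L_add a by (simp add: power2_eq_square algebra_simps)

lemma L_neighbour:
  "L (j + 2) a = - 1" "L (j + 3) a = - 2" "L (j + 4) a = - 1" "L (j + 5) a = 1"
  unfolding L_2 L_3 L_4 L_5 a by simp_all

text \<open>Of the six conditions \<open>L k (u + a) < (cmod (u + a))\<^sup>2\<close>, the one for k
  = j is exactly the outer cut. The others follow from it and the bounds on the hexagon.\<close>

lemma pull_neighbour: "pull a U0 = outer_cut j"
proof -
  have "u + a \<noteq> 0 \<and> (\<forall>k. L k (u + a) < (cmod (u + a))\<^sup>2) \<longleftrightarrow> 0 < (cmod u)\<^sup>2 + 2 * L j u + 1"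
    if "u \<in> U0" for u
  proof -
    have "1 < L j (u + a)" using U0_L'[OF that, of j] a by (simp add: L_add)
    then have nz: "u + a \<noteq> 0" by auto
    have b: "L j u < 1" "L (j + 1) u < 1" "L (j + 2) u < 1" "- 1 < L j u" "- 1 < L (j + 1) u" "- 1 < L (j + 2) u"
      using that by (simp_all add: U0_L U0_L')
    have "(\<forall>k. L k (u + a) < (cmod (u + a))\<^sup>2) \<longleftrightarrow> 0 < (cmod u)\<^sup>2 + 2 * L j u + 1"
      unfolding L_all[where P = "\<lambda>x. x < (cmod (u + a))\<^sup>2" and j = j]
      unfolding norm_neighbour L_add a using b zero_le_power2[of "cmod u"] unfolding L_2 by argo
    with nz show ?thesis by blast
  qed
  then show ?thesis by (auto simp: pull_U0 outer_cut_def)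
qed

text \<open>For the index opposite to j the terms 3 \<open>L j u\<close> and -2 \<open>L j u\<close>
  combine to \<open>L j u\<close>, which gives the inner circle. The other five circles miss the set
  that the outer cut leaves.\<close>

lemma pull_neighbour_outer_cut:
  "pull a (outer_cut k) = (if L (5 * k + 5) = L (j + 3) then inner_cut j else outer_cut j)"
proof -
  obtain i where "i < 6" and i: "L (5 * k + 5) = L (j + i)" using L_index by blast
  have ne: "L (j + i) \<noteq> L (j + 3)" if i: "i < 6" "i \<noteq> 3" for i
  proof -
    consider "i = 0" | "i = 1" | "i = 2" | "i = 4" | "i = 5" using i by linarith
    then have "L (j + i) a \<noteq> L (j + 3) a" using L_neighbour a by cases simp_all
    then show ?thesis by metis
  qed
  have main: "(0 < (cmod (u + a))\<^sup>2 + 2 * L (j + i) (u + a) + 1) \<longleftrightarrow> (i = 3 \<longrightarrow> 0 < (cmod u)\<^sup>2 + L j u)"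
    if "u \<in> outer_cut j" for u
  proof -
    define p q where "p = L j u" and "q = L (j + 1) u"
    have "u \<in> U0" using that by (simp add: outer_cut_def)
    then have b: "p < 1" "q < 1" "q - p < 1" "- 1 < p" "- 1 < q" "- 1 < q - p"
      using U0_L[of u j] U0_L[of u "j + 1"] U0_L[of u "j + 2"] U0_L'[of u j] U0_L'[of u "j + 1"] U0_L'[of u "j + 2"]
      unfolding L_2 p_def q_def by simp_all
    have g: "0 < (cmod u)\<^sup>2 + 2 * p + 1" using that by (simp add: outer_cut_def p_def)
    have N: "(cmod u)\<^sup>2 = p * p - p * q + q * q" using norm_L[of u j] by (simp add: p_def q_def power2_eq_square)
    have pos: "0 \<le> x * x - x * y + y * y" for x y :: real
    proof -
      have "x * x - x * y + y * y = (x - y / 2)\<^sup>2 + 3 / 4 * y\<^sup>2" by (simp add: power2_eq_square field_simps)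
      then show ?thesis by simp
    qed
    \<comment> \<open>These are the squared distances of u from the two vertices on the side
      \<open>L j z = -1\<close>.\<close>
    have v: "0 \<le> (cmod u)\<^sup>2 + p + q + 1" "0 \<le> (cmod u)\<^sup>2 + 2 * p - q + 1"
      using pos[of "p + 1" "q + 1"] pos[of "p + 1" q] unfolding N by (simp_all add: algebra_simps)
    have vals: "L j (u + a) = p + 2" "L (j + 1) (u + a) = q + 1" "L (j + 2) (u + a) = q - p - 1"
      "L (j + 3) (u + a) = - p - 2" "L (j + 4) (u + a) = - q - 1" "L (j + 5) (u + a) = p - q + 1"
      unfolding L_2 L_3 L_4 L_5 L_add a p_def q_def by simp_all
    have Nw: "(cmod (u + a))\<^sup>2 = (cmod u)\<^sup>2 + 3 * p + 3" by (simp add: norm_neighbour p_def)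
    consider "i = 0" | "i = 1" | "i = 2" | "i = 3" | "i = 4" | "i = 5" using \<open>i < 6\<close> by linarith
    then show ?thesis
    proof cases
      case 1
      have "0 < (cmod u)\<^sup>2 + 3 * p + 3 + 2 * (p + 2) + 1" using g b by argo
      then show ?thesis unfolding 1 add_0_right vals Nw by simp
    next
      case 2
      have "0 < (cmod u)\<^sup>2 + 3 * p + 3 + 2 * (q + 1) + 1" using g b by argo
      then show ?thesis unfolding 2 vals Nw by simp
    next
      case 3
      have "0 < (cmod u)\<^sup>2 + 3 * p + 3 + 2 * (q - p - 1) + 1" using v b by argo
      then show ?thesis unfolding 3 vals Nw by simp
    next
      case 4
      then show ?thesis unfolding 4 vals Nw by (simp add: p_def add.commute)
    next
      case 5
      have "0 < (cmod u)\<^sup>2 + 3 * p + 3 + 2 * (- q - 1) + 1" using v b by argo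
      then show ?thesis unfolding 5 vals Nw by simp
    next
      case 6
      have "0 < (cmod u)\<^sup>2 + 3 * p + 3 + 2 * (p - q + 1) + 1" using g b by argo
      then show ?thesis unfolding 6 vals Nw by simp
    qed
  qed
  have "inner_cut j \<subseteq> outer_cut j"
  proof
    fix u assume "u \<in> inner_cut j"
    then show "u \<in> outer_cut j" using U0_L'[of u j] by (simp add: outer_cut_def inner_cut_def)
  qed
  then show ?thesis
    unfolding pull_outer_cut pull_neighbour i using main ne[OF \<open>i < 6\<close>] by (auto simp: inner_cut_def outer_cut_def)
qed

end

lemma pull_regions:
  assumes a: "a \<in> J" and G: "G \<in> regions"
  shows "pull a G \<in> regions"
  using a
proof (cases rule: J_cases)
  case 1
  have "pull a G \<subseteq> pull a U0" by (intro pull_mono regions_subset G)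
  then show ?thesis using 1 pull_zero by (simp add: regions_def)
next
  case (2 j)
  note n = pull_neighbour[OF 2(2,3)] and nA = pull_neighbour_outer_cut[OF 2(2,3)] and val = 2(2,3) L_neighbour[OF 2(2,3)]
  have sub: "outer_cut j \<subseteq> U0" "inner_cut j \<subseteq> outer_cut j"
    using U0_L'[of _ j] by (fastforce simp: outer_cut_def inner_cut_def)+
  note half = half_plane_cases[OF a sub(1)]
  have idx: "L k = L j \<or> L k = L (j + 1) \<or> L k = L (j + 2) \<or> L k = L (j + 3) \<or> L k = L (j + 4) \<or> L k = L (j + 5)" for k
  proof -
    obtain i where "i < 6" "L k = L (j + i)" using L_index by blast
    moreover from \<open>i < 6\<close> have "i = 0 \<or> i = 1 \<or> i = 2 \<or> i = 3 \<or> i = 4 \<or> i = 5" by linarith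
    ultimately show ?thesis by auto
  qed
  \<comment> \<open>At a neighbour every \<open>L k\<close> is 1, 2, -1 or -2, so a translated
    diagonal never enters the hexagon.\<close>
  have pC: "pull a (half_cut k) = (if 0 < L (5 * k + 5) a then outer_cut j else {})" for k
  proof -
    have "L (5 * k + 5) a \<noteq> 0" using idx[of "5 * k + 5"] val by auto
    then show ?thesis
      using half(2,3)[where m = 0 and k = "5 * k + 5"] unfolding pull_half_cut n by auto
  qed
  \<comment> \<open>A side line moves onto a diagonal when the value at a is -1, which happens for
    the indices j + 2 and j + 4 only. This is the origin of the two intersections in
    \<open>regions\<close>.\<close>
  have pB: "pull a (inner_cut k) \<in> {outer_cut j, {}, outer_cut j \<inter> half_cut (j + 2), outer_cut j \<inter> half_cut (j + 4)}" for k
  proof -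
    let ?k = "5 * k + 5"
    have *: "pull a (inner_cut k) = {u \<in> outer_cut j. 0 < L ?k (u + a) + of_int 1}"
      unfolding pull_inner_cut n by simp
    consider "0 < L ?k a + of_int 1" | "L ?k a + of_int 1 < 0" | "L ?k a + of_int 1 = 0" by linarith
    then show ?thesis
    proof cases
      case 3
      then have "L ?k a = - 1" by simp
      then have "L ?k = L (j + 2) \<or> L ?k = L (j + 4)" using idx[of ?k] val by auto
      then show ?thesis unfolding * half(4)[OF 3] using L_cong_sets(3) by blast
    qed (simp_all only: * half(2,3) insert_iff simp_thms)
  qed
  \<comment> \<open>When the circle becomes the opposite one, j + 3, the diagonal gets index j + 3 -
    i, that is j + 1 or j + 5 modulo 6. There the value at a is 1, so the half plane contains the
    whole cut hexagon.\<close>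
  have pAC: "pull a (outer_cut k \<inter> half_cut (k + i)) \<in> {outer_cut j, inner_cut j, {}}" if i: "i = 2 \<or> i = 4" for k i
  proof (cases "L (5 * k + 5) = L (j + 3)")
    case True
    have "L (5 * (k + i) + 5) = L (j + (if i = 2 then 1 else 5))"
    proof -
      have "L (m + r) = L (m' + r)" if "L m = L m'" for m m' r
      proof (induction r)
        case 0 show ?case using that by simp
      next
        case (Suc r)
        have "L (Suc k) z = L k (inverse zeta * z)" for k z
          using L_rotate[of k "inverse zeta * z"] by (simp add: mult.assoc[symmetric])
        then show ?case using Suc by (simp add: fun_eq_iff)
      qed
      from this[OF True, of "5 * i"] have "L (5 * k + 5 + 5 * i) = L (j + 3 + 5 * i)" .
      moreover have "L (j + 3 + 5 * i) = L (j + (if i = 2 then 1 else 5))"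
      proof (cases "i = 2")
        case True
        have "j + 3 + 5 * i = j + 1 + 6 * 2" using True by simp
        moreover have "(if i = 2 then 1 else 5) = (1 :: nat)" using True by simp
        ultimately show ?thesis by (intro L_cong) (simp only: mod_mult_self2)
      next
        case False
        with i have "i = 4" by simp
        then have "j + 3 + 5 * i = j + 5 + 6 * 3" by simp
        moreover have "(if i = 2 then 1 else 5) = (5 :: nat)" using False by simp
        ultimately show ?thesis by (intro L_cong) (simp only: mod_mult_self2)
      qed
      ultimately show ?thesis by (simp add: algebra_simps)
    qed
    then have "pull a (half_cut (k + i)) = outer_cut j" unfolding pC using val by auto
    then show ?thesis unfolding pull_Int nA using sub(2) True by auto
  next
    case False
    then show ?thesis unfolding pull_Int nA pC by auto
  qed
  from G show ?thesis
  proof (cases rule: regions_cases)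
    case (4 k)
    show ?thesis using pB[of k] unfolding 4 by (elim insertE emptyE) (simp_all only: regions_intros)
  next
    case (6 k i)
    show ?thesis
      using pAC[OF 6(2), of k] unfolding 6(1) by (elim insertE emptyE) (simp_all only: regions_intros)
  qed (simp_all add: n nA pC regions_intros)
next
  case (3 j)
  note n = pull_far(1)[OF a 3(2)] and nA = pull_far(2)[OF a 3(2)]
  have pC: "pull a (half_cut k) \<in> {U0, {}, half_cut (5 * k + 5)}" for k
    using half_plane_cases(1)[OF a subset_refl, where m = 0 and k = "5 * k + 5"]
    unfolding pull_half_cut n by (simp add: half_cut_def Int_def)
  have pB: "pull a (inner_cut k) \<in> {U0, {}, half_cut (5 * k + 5)}" for k
    using half_plane_cases(1)[OF a subset_refl, where m = 1 and k = "5 * k + 5"]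
    unfolding pull_inner_cut n by (simp add: half_cut_def Int_def)
  have "pull a (outer_cut k \<inter> half_cut m) = pull a (half_cut m)" for k m
    unfolding pull_Int nA using pull_subset by blast
  note pAC = this
  from G show ?thesis
  proof (cases rule: regions_cases)
    case (4 k)
    show ?thesis using pB[of k] unfolding 4 by (elim insertE emptyE) (simp_all only: regions_intros)
  next
    case (5 k)
    show ?thesis using pC[of k] unfolding 5 by (elim insertE emptyE) (simp_all only: regions_intros)
  next
    case (6 k i)
    show ?thesis
      using pC[of "k + i"] unfolding 6(1) pAC by (elim insertE emptyE) (simp_all only: regions_intros)
  qed (simp_all add: n nA regions_intros)
qed

section \<open>Ranges of cylinder sets\<close>

lemma negligible_inverse: "negligible S \<Longrightarrow> negligible (inverse ` (S - {0 :: complex}))"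
  by (rule negligible_differentiable_image_negligible)
     (auto intro: negligible_subset differentiable_on_inverse differentiable_on_id)

lemma negligible_plus: "negligible S \<Longrightarrow> negligible ((+) (a :: complex) ` S)"
  by (rule negligible_translation)

lemma negligible_U_diff_U0: "negligible (U - U0)"
proof (rule negligible_subset[OF negligible_grid])
  show "U - U0 \<subseteq> grid"
  proof
    fix z assume "z \<in> U - U0"
    then obtain k where "\<not> L k z < 1" by (auto simp: U0_eq)
    moreover have "L k z \<le> 1" using \<open>z \<in> U - U0\<close> U_subset by (auto simp: closed_hexagon_def)
    ultimately have "\<not> L k z < 1" "L k z \<le> 1" by blast+
    then have "L k z = 1" by simp
    then show "z \<in> grid" by (auto simp: grid_def intro: exI[of _ k])
  qed
qed

text \<open>Off a null set T is one of countably many branches 1/z - b, and the inverse of each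
  branch preserves null sets.\<close>

lemma negligible_T_vimage:
  assumes "negligible X"
  shows "negligible {z. T z \<in> X}"
proof (rule negligible_subset)
  show "negligible ({0} \<union> inverse ` (grid - {0}) \<union> (\<Union>b\<in>J. inverse ` ((+) b ` X - {0})))"
    using countable_J
    by (intro negligible_Un negligible_countable_Union negligible_inverse negligible_grid)
       (auto intro: negligible_inverse negligible_plus assms)
  show "{z. T z \<in> X} \<subseteq> {0} \<union> inverse ` (grid - {0}) \<union> (\<Union>b\<in>J. inverse ` ((+) b ` X - {0}))"
  proof
    fix z assume z: "z \<in> {z. T z \<in> X}"
    have zi: "z = inverse (1 / z)" by simp
    show "z \<in> {0} \<union> inverse ` (grid - {0}) \<union> (\<Union>b\<in>J. inverse ` ((+) b ` X - {0}))"
    proof (cases "z = 0 \<or> 1 / z \<in> grid")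
      case True
      show ?thesis
      proof (cases "z = 0")
        case False
        then have "1 / z \<in> grid - {0}" using True by simp
        then show ?thesis using zi by blast
      qed blast
    next
      case False
      then obtain b u where b: "b \<in> J" "u \<in> U0" "1 / z = b + u" using tiling by blast
      then have "T z = 1 / z - b" using False nearest_add[OF b(1,2)] by (simp add: T_def)
      then have "1 / z \<in> (+) b ` X - {0}" using z False by (auto simp: image_iff intro!: bexI[of _ "1 / z - b"])
      then show ?thesis using b(1) zi by blast
    qed
  qed
qed

lemma negligible_T_power_vimage: "negligible X \<Longrightarrow> negligible {z. (T ^^ n) z \<in> X}"
proof (induction n arbitrary: X)
  case (Suc n)
  have "negligible {z. (T ^^ n) z \<in> {z. T z \<in> X}}"
    using Suc by (intro Suc.IH negligible_T_vimage)
  then show ?case by simp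
qed simp

lemma cylinder_range_Nil: "cylinder_range [] = U"
  by (simp add: cylinder_range_def cylinder_def)

text \<open>Appending a digit acts on the range alone, hence the induction from the right end of the
  list.\<close>

lemma cylinder_range_snoc:
  "cylinder_range (as @ [a]) = (\<lambda>w. 1 / w - a) ` {w \<in> cylinder_range as. w \<noteq> 0 \<and> nearest (1 / w) = a}"
proof -
  have cyl: "cylinder (as @ [a]) =
      {z \<in> cylinder as. (T ^^ length as) z \<noteq> 0 \<and> nearest (1 / (T ^^ length as) z) = a}"
    by (auto simp: cylinder_def digit_def Let_def nth_append less_Suc_eq split: if_splits)
  show ?thesis
    unfolding cylinder_range_def cyl by (auto simp: image_iff T_def)
qed

text \<open>If a + u is inside an open tile, 1/(a + u) has digit a, so the pulled back region lies
  in the new range. The rest of that range comes from the grid or from the null set left over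
  before.\<close>

lemma cylinder_range_region:
  "set as \<subseteq> J \<Longrightarrow> \<exists>G\<in>regions. G \<subseteq> cylinder_range as \<and> negligible (cylinder_range as - G)"
proof (induction as rule: rev_induct)
  case Nil
  show ?case
    unfolding cylinder_range_Nil using negligible_U_diff_U0 U0_subset_U regions_intros(2) by blast
next
  case (snoc a as)
  then obtain G where G: "G \<in> regions" "G \<subseteq> cylinder_range as" "negligible (cylinder_range as - G)" by auto
  have a: "a \<in> J" using snoc.prems by simp
  let ?R = "cylinder_range as"
  have "pull a G \<subseteq> cylinder_range (as @ [a])"
  proof
    fix u assume "u \<in> pull a G"
    then have u: "u \<in> U0" "u + a \<noteq> 0" "inverse (u + a) \<in> G" by (auto simp: pull_def)
    then have "nearest (1 / inverse (u + a)) = a" using nearest_add[OF a u(1)] by (simp add: add.commute inverse_eq_divide)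
    moreover have "u = 1 / inverse (u + a) - a" by (simp add: divide_inverse)
    ultimately show "u \<in> cylinder_range (as @ [a])"
      unfolding cylinder_range_snoc using u G(2)
      by (intro image_eqI[of _ _ "inverse (u + a)"]) auto
  qed
  moreover have "cylinder_range (as @ [a]) - pull a G \<subseteq> (+) (- a) ` (grid \<union> inverse ` ((?R - G) - {0}))"
  proof
    fix x assume x: "x \<in> cylinder_range (as @ [a]) - pull a G"
    then obtain w where w: "w \<in> ?R" "w \<noteq> 0" "nearest (1 / w) = a" "x = 1 / w - a"
      unfolding cylinder_range_snoc by blast
    have "1 / w \<in> grid \<union> inverse ` ((?R - G) - {0})"
    proof (cases "1 / w \<in> grid")
      case False
      then obtain b u where b: "b \<in> J" "u \<in> U0" "1 / w = b + u" using tiling by blast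
      then have "u = x" using nearest_add[OF b(1,2)] w by simp
      have "x + a = inverse w" using w by (simp add: inverse_eq_divide)
      then have "w \<notin> G" using x b(2) \<open>u = x\<close> w(2) by (auto simp: pull_def)
      then show ?thesis using w by (auto simp: inverse_eq_divide)
    qed simp
    then show "x \<in> (+) (- a) ` (grid \<union> inverse ` ((?R - G) - {0}))" using w(4) by (auto simp: image_iff)
  qed
  moreover have "negligible ((+) (- a) ` (grid \<union> inverse ` ((?R - G) - {0})))"
    by (intro negligible_plus negligible_Un negligible_grid negligible_inverse G(3))
  ultimately show ?case
    using pull_regions[OF a G(1)] negligible_subset by blast
qed

text \<open>What the interior of R has outside the closed witness is open and null, hence empty.
  Regularity then forces that interior into G.\<close>

lemma interior_eq_region:
  assumes "regular G" "G \<subseteq> R" "negligible (R - G)"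
  shows "interior R = G"
proof
  obtain K where K: "closed K" "G \<subseteq> K" "interior K \<subseteq> G" using assms(1) by (auto simp: regular_def)
  have "open (interior R - K)" using K(1) by (intro open_Diff open_interior)
  moreover have "negligible (interior R - K)"
    using assms(3) K(2) interior_subset[of R] by (auto intro: negligible_subset)
  ultimately have "interior R \<subseteq> K" using open_not_negligible by blast
  then show "interior R \<subseteq> G" using K(3) interior_maximal[OF _ open_interior, of R K] by blast
  show "G \<subseteq> interior R" using assms interior_maximal unfolding regular_def by blast
qed

lemma admissible_region:
  assumes "admissible as"
  obtains G where "G \<in> regions" "G \<noteq> {}" "interior (cylinder_range as) = G" "eq_ae (cylinder_range as) G"
proof -
  obtain G where G: "G \<in> regions" "G \<subseteq> cylinder_range as" "negligible (cylinder_range as - G)"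
    using cylinder_range_region[of as] assms by (auto simp: admissible_def)
  have "G \<noteq> {}"
  \<comment> \<open>An empty region would make the range null. The cylinder lies in the preimage of
    its range, so it would be null too, against its interior point.\<close>
  proof
    assume "G = {}"
    then have "negligible {z. (T ^^ length as) z \<in> cylinder_range as}"
      using G(3) by (intro negligible_T_power_vimage) simp
    then have "negligible (interior (cylinder as))"
      by (rule negligible_subset) (use interior_subset in \<open>auto simp: cylinder_range_def\<close>)
    then show False using assms open_not_negligible[OF open_interior] by (auto simp: admissible_def)
  qed
  moreover have "eq_ae (cylinder_range as) G"
    using G(2,3) by (simp add: eq_ae_def negligible_iff_null_sets Un_absorb2 Diff_eq_empty_iff[THEN iffD2])
  ultimately show thesis
    using that G interior_eq_region[OF regular_regions] by blast
qed

section \<open>Identification of the regions with the sets U_{k,l}\<close>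

lemma image_mult_eq:
  fixes c :: complex
  assumes "c \<noteq> 0" "\<And>z. c * z \<in> S' \<longleftrightarrow> z \<in> S"
  shows "(\<lambda>z. c * z) ` S = S'"
proof
  show "S' \<subseteq> (\<lambda>z. c * z) ` S"
  proof
    fix y assume "y \<in> S'"
    moreover have "y = c * (y / c)" using assms(1) by simp
    ultimately show "y \<in> (\<lambda>z. c * z) ` S" using assms(2)[of "y / c"] by (metis image_eqI)
  qed
qed (use assms(2) in auto)

lemma norm_rotate: "cmod (zeta ^ j * z) = cmod z"
  by (simp add: norm_mult norm_power)

lemma L_rotate_inverse: "L k (zeta ^ j * z) = L (k + 5 * j) z"
proof -
  have "L k = L (k + 5 * j + j)" by (rule L_cong) simp
  then show ?thesis using L_rotate_power[of "k + 5 * j" j z] by simp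
qed

lemma rotate_U0: "zeta ^ j * z \<in> U0 \<longleftrightarrow> z \<in> U0"
proof
  assume "z \<in> U0"
  then show "zeta ^ j * z \<in> U0" by (simp add: U0_eq L_rotate_inverse)
next
  assume "zeta ^ j * z \<in> U0"
  then have "L (k + j) (zeta ^ j * z) < 1" for k by (simp add: U0_eq)
  then show "z \<in> U0" by (simp add: U0_eq L_rotate_power)
qed

lemma rotate_outer_cut: "zeta ^ j * z \<in> outer_cut (k + j) \<longleftrightarrow> z \<in> outer_cut k"
  and rotate_inner_cut: "zeta ^ j * z \<in> inner_cut (k + j) \<longleftrightarrow> z \<in> inner_cut k"
  and rotate_half_cut: "zeta ^ j * z \<in> half_cut (k + j) \<longleftrightarrow> z \<in> half_cut k"
  by (simp_all only: outer_cut_def inner_cut_def half_cut_def mem_Collect_eq rotate_U0 norm_rotate L_rotate_power)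

lemma Im_less_iff: "Im z < sqrt 3 * Re z \<longleftrightarrow> 0 < L 5 z" and Im_greater_iff: "sqrt 3 * Re z < Im z \<longleftrightarrow> 0 < L 2 z"
proof -
  have L5: "L 5 z = Re z - sqrt 3 / 3 * Im z" and L2: "L 2 z = sqrt 3 / 3 * Im z - Re z"
    using L_5[of 0 z] L_2[of 0 z] unfolding add_0 L_0 L_1 by (simp_all add: field_simps)
  have "sqrt 3 * L 5 z = sqrt 3 * Re z - Im z" "sqrt 3 * L 2 z = Im z - sqrt 3 * Re z"
    unfolding L5 L2 by (simp_all add: algebra_simps)
  moreover have "0 < sqrt 3 * x \<longleftrightarrow> 0 < x" for x by (simp add: zero_less_mult_iff)
  ultimately show "Im z < sqrt 3 * Re z \<longleftrightarrow> 0 < L 5 z" "sqrt 3 * Re z < Im z \<longleftrightarrow> 0 < L 2 z"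
    by (metis diff_gt_0_iff_gt)+
qed

lemma U11_eq: "U11 = outer_cut 0" and U21_eq: "U21 = inner_cut 0" and U31_eq: "U31 = half_cut 2"
  and U41_eq: "U41 = outer_cut 0 \<inter> half_cut 2" and U51_eq: "U51 = outer_cut 1 \<inter> half_cut 5"
proof -
  show 1: "U11 = outer_cut 0"
    using outer_disc_iff[of _ 0] by (auto simp: U11_def outer_cut_def)
  show "U21 = inner_cut 0"
    using inner_disc_iff[of _ 0] by (auto simp: U21_def inner_cut_def)
  show "U31 = half_cut 2"
    unfolding U31_def half_cut_def Im_greater_iff by blast
  show "U41 = outer_cut 0 \<inter> half_cut 2"
    unfolding U41_def 1 half_cut_def Im_greater_iff by (auto simp: outer_cut_def)
  have "(\<lambda>z. zeta * z) ` U11 = outer_cut 1"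
    unfolding 1 by (rule image_mult_eq) (use rotate_outer_cut[of 1 _ 0] in simp_all)
  then show "U51 = outer_cut 1 \<inter> half_cut 5"
    unfolding U51_def half_cut_def Im_less_iff by (auto simp: outer_cut_def)
qed

lemma U_sets_eq:
  "U_sets 1 (Suc j) = outer_cut j" "U_sets 2 (Suc j) = inner_cut j" "U_sets 3 (Suc j) = half_cut (2 + j)"
  "U_sets 4 (Suc j) = outer_cut j \<inter> half_cut (2 + j)" "U_sets 5 (Suc j) = outer_cut (1 + j) \<inter> half_cut (5 + j)"
proof -
  have lists: "[A, B, C, D, E] ! (1 - 1) = A" "[A, B, C, D, E] ! (2 - 1) = B" "[A, B, C, D, E] ! (3 - 1) = C"
    "[A, B, C, D, E] ! (4 - 1) = D" "[A, B, C, D, E] ! (5 - 1) = E" for A B C D E :: "complex set"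
    by (simp_all add: eval_nat_numeral)
  have nz: "zeta ^ j \<noteq> 0" by simp
  note rot = rotate_outer_cut[of j _ 0, unfolded add_0] rotate_inner_cut[of j _ 0, unfolded add_0] rotate_outer_cut[of j] rotate_half_cut[of j]
  show "U_sets 1 (Suc j) = outer_cut j" "U_sets 2 (Suc j) = inner_cut j" "U_sets 3 (Suc j) = half_cut (2 + j)"
    "U_sets 4 (Suc j) = outer_cut j \<inter> half_cut (2 + j)" "U_sets 5 (Suc j) = outer_cut (1 + j) \<inter> half_cut (5 + j)"
    unfolding U_sets_def lists U11_eq U21_eq U31_eq U41_eq U51_eq diff_Suc_1
    by (rule image_mult_eq[OF nz], simp only: Int_iff rot)+
qed

lemma region_U_sets:
  assumes "G \<in> regions" "G \<noteq> {}" "G \<noteq> U0"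
  shows "\<exists>k\<in>{1..5}. \<exists>l\<in>{1..6}. G = U_sets k l"
proof -
  have main: "\<exists>k\<in>{1..5}. \<exists>l\<in>{1..6}. G = U_sets k l" if "k \<in> {1..5}" "G = U_sets k (Suc (j mod 6))" for k j
    using that mod_less_divisor[of 6 j] by (intro bexI[of _ k] bexI[of _ "Suc (j mod 6)"]) auto
  have c: "L (i + j mod 6) = L (i + j)" "L (j mod 6) = L j" for i j
    by (rule L_cong, simp add: mod_simps)+
  note cs = L_cong_sets[OF c(1)] L_cong_sets[OF c(2)]
  from assms(1) show ?thesis
  proof (cases rule: regions_cases)
    case (3 k)
    then show ?thesis by (intro main[of 1 k]) (simp_all only: U_sets_eq cs, simp)
  next
    case (4 k)
    then show ?thesis by (intro main[of 2 k]) (simp_all only: U_sets_eq cs, simp)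
  next
    case (5 k)
    \<comment> \<open>The model half plane has index 2, so index k is reached by rotating k - 2
      times, written k + 4.\<close>
    have "L (2 + (k + 4)) = L k" by (rule L_cong) simp
    then have "half_cut (2 + (k + 4)) = half_cut k" by (rule L_cong_sets)
    then show ?thesis using 5 by (intro main[of 3 "k + 4"]) (simp_all only: U_sets_eq cs, simp)
  next
    case (6 k i)
    then consider "i = 2" | "i = 4" by blast
    then show ?thesis
    proof cases
      case 1
      then show ?thesis using 6 by (intro main[of 4 k]) (simp_all only: U_sets_eq cs add.commute, simp)
    next
      case 2
      \<comment> \<open>The fifth model has indices 1 and 5; k - 1 rotations, written k + 5, carry
        them to k and k + 4.\<close>
      have "L (1 + (k + 5)) = L k" "L (5 + (k + 5)) = L (k + 4)"
        using L_mod[of "k + 4 + 6"] L_mod[of "k + 4"] L_mod[of "k + 6"] L_mod[of k]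
        by (simp_all only: mod_add_self2) (simp_all add: ac_simps)
      then have e: "outer_cut (1 + (k + 5)) = outer_cut k" "half_cut (5 + (k + 5)) = half_cut (k + 4)"
        using L_cong_sets(1)[of "1 + (k + 5)" k] L_cong_sets(3)[of "5 + (k + 5)" "k + 4"] by simp_all
      then show ?thesis using 6 2 by (intro main[of 5 "k + 5"]) (simp_all only: U_sets_eq cs e, simp)
    qed
  qed (use assms in auto)
qed

section \<open>Decomposition into pieces\<close>

text \<open>This null set contains all curves that bound regions or pieces. Off it every inequality
  defining them is strict one way or the other.\<close>

definition exceptional :: "complex set" where
  "exceptional = grid \<union> {z. \<exists>k. (cmod z)\<^sup>2 + 2 * L k z + 1 = 0} \<union> {z. \<exists>k. (cmod z)\<^sup>2 + L k z = 0}"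

lemma negligible_exceptional: "negligible exceptional"
proof -
  have s: "negligible {z. cmod (z + c) = rad}" for c
  proof -
    have "{z. cmod (z + c) = rad} = sphere (- c) rad"
      by (auto simp: dist_norm norm_minus_commute[of "- c"])
    then show ?thesis by (simp add: negligible_sphere)
  qed
  have "{z. (cmod z)\<^sup>2 + 2 * L k z + 1 = 0} \<subseteq> {z. cmod (z + 2 / 3 * (eta * zeta ^ k)) = rad}"
    "{z. (cmod z)\<^sup>2 + L k z = 0} \<subseteq> {z. cmod (z + 1 / 3 * (eta * zeta ^ k)) = rad}" for k
    using outer_disc_iff[of _ k] outer_disc_le[of _ k] inner_disc_iff[of _ k] inner_disc_le[of _ k]
    by (fastforce simp: less_le)+
  then have n: "negligible {z. (cmod z)\<^sup>2 + 2 * L k z + 1 = 0}" "negligible {z. (cmod z)\<^sup>2 + L k z = 0}" for k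
    using s negligible_subset by blast+
  have "exceptional = grid \<union> (\<Union>k. {z. (cmod z)\<^sup>2 + 2 * L k z + 1 = 0}) \<union> (\<Union>k. {z. (cmod z)\<^sup>2 + L k z = 0})"
    by (auto simp: exceptional_def)
  also have "negligible \<dots>"
    by (intro negligible_Un negligible_grid negligible_countable_Union) (auto intro: n)
  finally show ?thesis .
qed

lemma rotate_exceptional: "zeta ^ j * z \<in> exceptional \<longleftrightarrow> z \<in> exceptional"
proof -
  have *: "(\<exists>k. P (L k (zeta ^ j * z))) \<longleftrightarrow> (\<exists>k. P (L k z))" for P
    using L_rotate_power[of _ j z] L_rotate_inverse[of _ j z] by metis
  show ?thesis
    unfolding exceptional_def grid_def Un_iff mem_Collect_eq norm_rotate
    using *[of "\<lambda>x. x \<in> \<int>"] *[of "\<lambda>x. (cmod z)\<^sup>2 + 2 * x + 1 = 0"] *[of "\<lambda>x. (cmod z)\<^sup>2 + x = 0"]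
    by blast
qed

lemma not_exceptional:
  assumes "z \<notin> exceptional"
  shows "L k z \<noteq> 0" "(cmod z)\<^sup>2 + 2 * L k z + 1 \<noteq> 0" "(cmod z)\<^sup>2 + L k z \<noteq> 0"
proof -
  show "L k z \<noteq> 0"
  proof
    assume "L k z = 0"
    then have "L k z \<in> \<int>" by simp
    with assms show False unfolding exceptional_def grid_def by blast
  qed
  show "(cmod z)\<^sup>2 + 2 * L k z + 1 \<noteq> 0" "(cmod z)\<^sup>2 + L k z \<noteq> 0"
    using assms unfolding exceptional_def by blast+
qed

lemma U_not_exceptional: "z \<in> U \<Longrightarrow> z \<notin> exceptional \<Longrightarrow> z \<in> U0"
proof -
  assume z: "z \<in> U" "z \<notin> exceptional"
  have "L k z < 1" for k
  proof -
    have "L k z \<le> 1" using z(1) U_subset by (auto simp: closed_hexagon_def)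
    moreover have "L k z \<noteq> 1"
    proof
      assume "L k z = 1"
      then have "L k z \<in> \<int>" by simp
      with z(2) show False unfolding exceptional_def grid_def by blast
    qed
    ultimately show ?thesis by simp
  qed
  then show "z \<in> U0" by (simp add: U0_eq)
qed

text \<open>
  In the sector $0 < \arg z < \pi / 3$ the pieces are cut out by three circles through the centroid
  of the triangle with vertices $0, 1, \zeta$. With $N = |z|^2$ their defining functions are
  $N - p + q$, $N - q$ and $N - 2 p + 1$; the sign patterns of these determine the piece.
\<close>

definition norm_form :: "real \<Rightarrow> real \<Rightarrow> real" where "norm_form p q = p * p - p * q + q * q"

lemma norm_form_nonneg: "0 \<le> norm_form p q"
proof -
  have "norm_form p q = (p - q / 2)\<^sup>2 + 3 / 4 * q\<^sup>2" by (simp add: norm_form_def power2_eq_square field_simps)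
  then show ?thesis by simp
qed

text \<open>The three circles meet in the centroid (2/3, 1/3), and the sum is three times the
  squared distance from it. So no point lies in all three open discs.\<close>

lemma circles_sum: "0 \<le> (norm_form p q - p + q) + (norm_form p q - q) + (norm_form p q - 2 * p + 1)"
  using norm_form_nonneg[of "p - 2 / 3" "q - 1 / 3"] by (simp add: norm_form_def field_simps)

text \<open>Since a + b + c = 0, the left side equals -(ab + bc + ca) and is symmetric. It can thus
  be compared with whichever of the three numbers is largest.\<close>

lemma max_bound:
  fixes a b c :: real
  assumes "a + b + c = 0" "a \<le> c" "b \<le> c" "c \<le> 1 / 3"
  shows "c * c - a * b \<le> c"
proof -
  have c: "0 \<le> c" using assms by linarith
  have "0 \<le> (c - a) * (c - b)" using assms by simp
  also have "(c - a) * (c - b) = c * c - c * (a + b) + a * b" by (simp add: algebra_simps)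
  also have "a + b = - c" using assms by simp
  finally have "- (a * b) \<le> 2 * (c * c)" by simp
  moreover have "c * c \<le> 1 / 3 * c" using c assms by (intro mult_right_mono)
  ultimately show ?thesis by simp
qed

text \<open>The three discs cover the triangle $0, 1, \zeta$.\<close>

lemma circles_cover:
  assumes "0 < q" "q < p" "p < 1"
    and a: "0 < norm_form p q - p + q" and b: "0 < norm_form p q - q" and d: "0 < norm_form p q - 2 * p + 1"
  shows False
proof -
  \<comment> \<open>These coordinates are centred at the centroid and at most 1/3 on the triangle.
    Each circle function is the squared distance from the centroid minus one of them.\<close>
  define x y z where "x = 1 / 3 - q" and "y = q - p + 1 / 3" and "z = p - 2 / 3"
  have s: "x + y + z = 0" "x \<le> 1 / 3" "y \<le> 1 / 3" "z \<le> 1 / 3" using assms by (simp_all add: x_def y_def z_def)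
  have n: "norm_form p q - p + 1 / 3 = z * z - x * y" "norm_form p q - p + 1 / 3 = x * x - y * z" "norm_form p q - p + 1 / 3 = y * y - z * x"
    by (simp_all add: norm_form_def x_def y_def z_def field_simps)
  have less: "x < norm_form p q - p + 1 / 3" "y < norm_form p q - p + 1 / 3" "z < norm_form p q - p + 1 / 3"
    using a b d by (simp_all add: x_def y_def z_def)
  consider "x \<le> z" "y \<le> z" | "y \<le> x" "z \<le> x" | "z \<le> y" "x \<le> y" by linarith
  then show False
  proof cases
    case 1 with max_bound[of x y z] s n(1) less show False by simp
  next
    case 2 with max_bound[of y z x] s n(2) less show False by simp
  next
    case 3 with max_bound[of z x y] s n(3) less show False by simp
  qed
qed

text \<open>The pieces \<open>V21\<close> and \<open>V61\<close> are cut by x > 0 and y > 0 and not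
  by the sector. The points beyond the ray through zeta lie in the closed disc around sqrt(-3)/3,
  which these pieces avoid.\<close>

lemma sector_inside: "0 \<le> p \<Longrightarrow> p \<le> q \<Longrightarrow> q \<le> 1 \<Longrightarrow> norm_form p q \<le> q"
proof -
  assume "0 \<le> p" "p \<le> q" "q \<le> 1"
  then have "0 \<le> q * (1 - q)" "0 \<le> p * (q - p)" by simp_all
  then show ?thesis by (simp add: norm_form_def algebra_simps)
qed

text \<open>The circle function is (p - 1)^2 + q (q - p), so it is negative only if q (q - p)
  is.\<close>

lemma outer_disc_sector: "0 < p \<Longrightarrow> norm_form p q - 2 * p + 1 < 0 \<Longrightarrow> 0 < q \<and> q < p"
proof -
  assume p: "0 < p" and n: "norm_form p q - 2 * p + 1 < 0"
  have "norm_form p q - 2 * p + 1 = (p - 1)\<^sup>2 + q * (q - p)" by (simp add: norm_form_def power2_eq_square algebra_simps)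
  then have "q * (q - p) < 0" using n zero_le_power2[of "p - 1"] by linarith
  then show ?thesis using p by (auto simp: mult_less_0_iff)
qed

context
  fixes z :: complex and p q :: real
  assumes pq: "p = L 0 z" "q = L 1 z"
begin

lemma V_values:
  "(cmod z)\<^sup>2 = norm_form p q" "L 0 z = p" "L 1 z = q" "L 2 z = q - p" "L 3 z = - p" "L 4 z = - q" "L 5 z = p - q"
proof -
  show "(cmod z)\<^sup>2 = norm_form p q" using norm_L[of z 0] by (simp add: pq norm_form_def power2_eq_square)
  show "L 2 z = q - p" "L 3 z = - p" "L 4 z = - q" "L 5 z = p - q"
    using L_2[of 0 z] L_3[of 0 z] L_4[of 0 z] L_5[of 0 z] unfolding add_0 pq by simp_all
qed (simp_all add: pq)

lemma V_discs:
  "cmod (z - 1 / 3 * cnj eta) < rad \<longleftrightarrow> norm_form p q - p + q < 0"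
  "rad < cmod (z - 1 / 3 * cnj eta) \<longleftrightarrow> 0 < norm_form p q - p + q"
  "cmod (z - 1 / 3 * sqrt_minus3) < rad \<longleftrightarrow> norm_form p q - q < 0"
  "rad < cmod (z - 1 / 3 * sqrt_minus3) \<longleftrightarrow> 0 < norm_form p q - q"
  "cmod (z - 2 / 3 * eta) < rad \<longleftrightarrow> norm_form p q - 2 * p + 1 < 0"
  "rad < cmod (z - 2 / 3 * eta) \<longleftrightarrow> 0 < norm_form p q - 2 * p + 1"
  "Re z > 0 \<longleftrightarrow> q < 2 * p" "Im z > 0 \<longleftrightarrow> 0 < q" "Im z < sqrt 3 * Re z \<longleftrightarrow> q < p"
proof -
  have "eta * zeta ^ 2 = - cnj eta"
    unfolding power2_eq_square zeta_square by (simp add: complex_eq_iff eta_sel zeta_sel)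
  then have c: "z - 1 / 3 * cnj eta = z + 1 / 3 * (eta * zeta ^ 2)" by simp
  have "zeta ^ 4 = zeta ^ 3 * zeta" by (simp add: eval_nat_numeral)
  then have "eta * zeta ^ 4 = - sqrt_minus3"
    by (simp add: zeta_power_3 complex_eq_iff eta_sel zeta_sel)
  then have s: "z - 1 / 3 * sqrt_minus3 = z + 1 / 3 * (eta * zeta ^ 4)" by simp
  have e: "z - 2 / 3 * eta = z + 2 / 3 * (eta * zeta ^ 3)" by (simp add: zeta_power_3)
  show "cmod (z - 1 / 3 * cnj eta) < rad \<longleftrightarrow> norm_form p q - p + q < 0"
    "rad < cmod (z - 1 / 3 * cnj eta) \<longleftrightarrow> 0 < norm_form p q - p + q"
    "cmod (z - 1 / 3 * sqrt_minus3) < rad \<longleftrightarrow> norm_form p q - q < 0"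
    "rad < cmod (z - 1 / 3 * sqrt_minus3) \<longleftrightarrow> 0 < norm_form p q - q"
    "cmod (z - 2 / 3 * eta) < rad \<longleftrightarrow> norm_form p q - 2 * p + 1 < 0"
    "rad < cmod (z - 2 / 3 * eta) \<longleftrightarrow> 0 < norm_form p q - 2 * p + 1"
    unfolding c s e inner_disc_iff inner_disc_le outer_disc_iff outer_disc_le V_values by argo+
  have "2 * p - q = 2 * Re z" unfolding pq L_0 L_1 by simp
  then show "Re z > 0 \<longleftrightarrow> q < 2 * p" by linarith
  show "Im z > 0 \<longleftrightarrow> 0 < q" unfolding pq L_1 by (simp add: zero_less_mult_iff)
  show "Im z < sqrt 3 * Re z \<longleftrightarrow> q < p" unfolding Im_less_iff V_values by simp
qed

text \<open>Of the eight sign patterns, \<open>circles_sum\<close> excludes three negative signs and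
  \<open>circles_cover\<close> three positive ones. Each definition prescribes only some signs; the
  others are forced, and so is the sector.\<close>

lemma V_patterns:
  assumes U: "z \<in> U" and nb: "z \<notin> exceptional"
  defines "a \<equiv> norm_form p q - p + q" and "b \<equiv> norm_form p q - q" and "d \<equiv> norm_form p q - 2 * p + 1"
  shows "z \<in> V11 \<longleftrightarrow> 0 < q \<and> q < p \<and> a < 0 \<and> b < 0 \<and> 0 < d"
    "z \<in> V21 \<longleftrightarrow> 0 < q \<and> q < p \<and> a < 0 \<and> 0 < b \<and> 0 < d"
    "z \<in> V31 \<longleftrightarrow> 0 < q \<and> q < p \<and> 0 < a \<and> b < 0 \<and> 0 < d"
    "z \<in> V41 \<longleftrightarrow> 0 < q \<and> q < p \<and> a < 0 \<and> 0 < b \<and> d < 0"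
    "z \<in> V51 \<longleftrightarrow> 0 < q \<and> q < p \<and> 0 < a \<and> b < 0 \<and> d < 0"
    "z \<in> V61 \<longleftrightarrow> 0 < q \<and> q < p \<and> 0 < a \<and> 0 < b \<and> d < 0"
    "0 < q \<Longrightarrow> q < p \<Longrightarrow> (a < 0 \<and> b < 0 \<and> 0 < d) \<or> (a < 0 \<and> 0 < b \<and> 0 < d) \<or> (0 < a \<and> b < 0 \<and> 0 < d)
      \<or> (a < 0 \<and> 0 < b \<and> d < 0) \<or> (0 < a \<and> b < 0 \<and> d < 0) \<or> (0 < a \<and> 0 < b \<and> d < 0)"
proof -
  have "z \<in> U0" using U_not_exceptional U nb .
  then have lt: "p < 1" "q < 1" using U0_L[of z 0] U0_L[of z 1] by (simp_all add: pq)
  have ne: "a \<noteq> 0" "b \<noteq> 0" "d \<noteq> 0" "p \<noteq> q"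
    using not_exceptional(3)[OF nb, of 2] not_exceptional(3)[OF nb, of 4] not_exceptional(2)[OF nb, of 3] not_exceptional(1)[OF nb, of 2]
    unfolding V_values a_def b_def d_def by auto
  have sum: "0 \<le> a + b + d" using circles_sum unfolding a_def b_def d_def .
  have cover: "\<not> (0 < a \<and> 0 < b \<and> 0 < d)" if "0 < q" "q < p"
    using circles_cover[of q p] that lt unfolding a_def b_def d_def by blast
  have sa: "q < p" if "a < 0" using that norm_form_nonneg[of p q] by (simp add: a_def)
  have sb: "0 < q" if "b < 0" using that norm_form_nonneg[of p q] by (simp add: b_def)
  have sd: "0 < q" "q < p" if "d < 0"
  proof -
    have "0 < p" using that norm_form_nonneg[of p q] by (simp add: d_def)
    with that outer_disc_sector[of p q] show "0 < q" "q < p" by (simp_all add: d_def)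
  qed
  have sq: "q < p" if "0 < b" "0 < q" "q < 2 * p"
    using sector_inside[of p q] that lt unfolding b_def by linarith
  note V = V_discs[folded a_def b_def d_def]
  show "z \<in> V11 \<longleftrightarrow> 0 < q \<and> q < p \<and> a < 0 \<and> b < 0 \<and> 0 < d"
    unfolding V11_def mem_Collect_eq V using U sa sb sum by auto
  show "z \<in> V21 \<longleftrightarrow> 0 < q \<and> q < p \<and> a < 0 \<and> 0 < b \<and> 0 < d"
    unfolding V21_def mem_Collect_eq V using U sq cover ne by fastforce
  show "z \<in> V31 \<longleftrightarrow> 0 < q \<and> q < p \<and> 0 < a \<and> b < 0 \<and> 0 < d"
    unfolding V31_def mem_Collect_eq V using U cover ne by fastforce
  show "z \<in> V41 \<longleftrightarrow> 0 < q \<and> q < p \<and> a < 0 \<and> 0 < b \<and> d < 0"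
    unfolding V41_def mem_Collect_eq V using U sd sum by auto
  show "z \<in> V51 \<longleftrightarrow> 0 < q \<and> q < p \<and> 0 < a \<and> b < 0 \<and> d < 0"
    unfolding V51_def mem_Collect_eq V using U sd sum by auto
  show "z \<in> V61 \<longleftrightarrow> 0 < q \<and> q < p \<and> 0 < a \<and> 0 < b \<and> d < 0"
    unfolding V61_def mem_Collect_eq V using U sq cover ne by fastforce
  show "0 < q \<Longrightarrow> q < p \<Longrightarrow> (a < 0 \<and> b < 0 \<and> 0 < d) \<or> (a < 0 \<and> 0 < b \<and> 0 < d) \<or> (0 < a \<and> b < 0 \<and> 0 < d)
      \<or> (a < 0 \<and> 0 < b \<and> d < 0) \<or> (0 < a \<and> b < 0 \<and> d < 0) \<or> (0 < a \<and> 0 < b \<and> d < 0)"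
    using cover sum ne by linarith
qed

end

section \<open>Every region is a union of pieces\<close>

abbreviation base_pieces :: "complex set list" where
  "base_pieces \<equiv> [V11, V21, V31, V41, V51, V61]"

lemma V_family_eq: "V_family = {(\<lambda>z. zeta ^ j * z) ` V | j V. j < 6 \<and> V \<in> set base_pieces}"
proof (intro subset_antisym subsetI)
  fix X assume "X \<in> V_family"
  then obtain k l where kl: "X = V_sets k l" "k \<in> {1..6}" "l \<in> {1..6}"
    unfolding V_family_def by blast
  have "length base_pieces = 6" "k - 1 < 6" using kl(2) by auto
  then have "k - 1 < length base_pieces" by (simp only:)
  then have "base_pieces ! (k - 1) \<in> set base_pieces" by (rule nth_mem)
  moreover have "l - 1 < 6" using kl(3) by auto
  ultimately show "X \<in> {(\<lambda>z. zeta ^ j * z) ` V | j V. j < 6 \<and> V \<in> set base_pieces}"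
    unfolding kl(1) V_sets_def by blast
next
  fix X assume "X \<in> {(\<lambda>z. zeta ^ j * z) ` V | j V. j < 6 \<and> V \<in> set base_pieces}"
  then obtain j V where X: "X = (\<lambda>z. zeta ^ j * z) ` V" "j < 6" "V \<in> set base_pieces" by blast
  then obtain i where "i < length base_pieces" and V: "V = base_pieces ! i" unfolding in_set_conv_nth by blast
  then have "Suc i \<in> {1..6}" "Suc j \<in> {1..6}" using X(2) by simp_all
  moreover have "X = V_sets (Suc i) (Suc j)" unfolding X(1) V V_sets_def diff_Suc_1 ..
  ultimately show "X \<in> V_family" unfolding V_family_def by blast
qed

lemma finite_V_family: "finite V_family"
  unfolding V_family_eq by (rule finite_image_set2) (simp_all only: finite_set Collect_mem_eq finite_Collect_less_nat)

lemma base_piece_subset: "V \<in> set base_pieces \<Longrightarrow> V \<subseteq> U"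
  by (auto simp: V11_def V21_def V31_def V41_def V51_def V61_def)

definition decided :: "complex set \<Rightarrow> complex set \<Rightarrow> bool" where
  "decided V G \<longleftrightarrow> V - exceptional \<subseteq> G \<or> V \<inter> G \<subseteq> exceptional"

lemma decided_Int: "decided V G \<Longrightarrow> decided V H \<Longrightarrow> decided V (G \<inter> H)"
  unfolding decided_def by blast

lemma decided_rotate:
  assumes "decided V G" "\<And>z. zeta ^ j * z \<in> H \<longleftrightarrow> z \<in> G"
  shows "decided ((\<lambda>z. zeta ^ j * z) ` V) H"
  using assms(1) unfolding decided_def
proof
  assume "V - exceptional \<subseteq> G"
  then show "(\<lambda>z. zeta ^ j * z) ` V - exceptional \<subseteq> H \<or> (\<lambda>z. zeta ^ j * z) ` V \<inter> H \<subseteq> exceptional"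
    by (auto simp: rotate_exceptional assms(2))
next
  assume "V \<inter> G \<subseteq> exceptional"
  then show "(\<lambda>z. zeta ^ j * z) ` V - exceptional \<subseteq> H \<or> (\<lambda>z. zeta ^ j * z) ` V \<inter> H \<subseteq> exceptional"
    by (auto simp: rotate_exceptional assms(2))
qed

text \<open>Only the inner circles 2 and 4 and the outer circle 3 cross the open triangle 0, 1,
  zeta, and the sign pattern of the piece settles these three. All other circles and all diagonals
  have a constant sign there.\<close>

lemma decided_base:
  assumes V: "V \<in> set base_pieces"
  shows "decided V (outer_cut k)" "decided V (inner_cut k)" "decided V (half_cut k)"
proof -
  have pattern: "\<exists>sa sb sd. \<forall>z\<in>V - exceptional. z \<in> U0 \<and> 0 < L 1 z \<and> L 1 z < L 0 z \<and>
      (0 < (cmod z)\<^sup>2 + L 2 z \<longleftrightarrow> sa) \<and> (0 < (cmod z)\<^sup>2 + L 4 z \<longleftrightarrow> sb) \<and> (0 < (cmod z)\<^sup>2 + 2 * L 3 z + 1 \<longleftrightarrow> sd)"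
  proof -
    have a: "z \<in> U \<and> z \<in> U0 \<and> z \<notin> exceptional" if "z \<in> V - exceptional" for z
      using base_piece_subset[OF V] that U_not_exceptional by blast
    have v: "(0 < (cmod z)\<^sup>2 + L 2 z \<longleftrightarrow> 0 < norm_form (L 0 z) (L 1 z) - L 0 z + L 1 z) \<and>
       (0 < (cmod z)\<^sup>2 + L 4 z \<longleftrightarrow> 0 < norm_form (L 0 z) (L 1 z) - L 1 z) \<and>
       (0 < (cmod z)\<^sup>2 + 2 * L 3 z + 1 \<longleftrightarrow> 0 < norm_form (L 0 z) (L 1 z) - 2 * L 0 z + 1)" for z
      unfolding V_values(1,4-6)[OF refl refl] by argo
    note P = V_patterns[OF refl refl]
    consider "V = V11" | "V = V21" | "V = V31" | "V = V41" | "V = V51" | "V = V61" using V by auto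
    then show ?thesis
    proof cases
      case 1 show ?thesis
        by (rule exI[of _ False], rule exI[of _ False], rule exI[of _ True])
           (use a v P(1) 1 in \<open>auto dest: less_not_sym\<close>)
    next
      case 2 show ?thesis
        by (rule exI[of _ False], rule exI[of _ True], rule exI[of _ True])
           (use a v P(2) 2 in \<open>auto dest: less_not_sym\<close>)
    next
      case 3 show ?thesis
        by (rule exI[of _ True], rule exI[of _ False], rule exI[of _ True])
           (use a v P(3) 3 in \<open>auto dest: less_not_sym\<close>)
    next
      case 4 show ?thesis
        by (rule exI[of _ False], rule exI[of _ True], rule exI[of _ False])
           (use a v P(4) 4 in \<open>auto dest: less_not_sym\<close>)
    next
      case 5 show ?thesis
        by (rule exI[of _ True], rule exI[of _ False], rule exI[of _ False])
           (use a v P(5) 5 in \<open>auto dest: less_not_sym\<close>)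
    next
      case 6 show ?thesis
        by (rule exI[of _ True], rule exI[of _ True], rule exI[of _ False])
           (use a v P(6) 6 in \<open>auto dest: less_not_sym\<close>)
    qed
  qed
  then obtain sa sb sd where S: "\<And>z. z \<in> V - exceptional \<Longrightarrow> z \<in> U0 \<and> 0 < L 1 z \<and> L 1 z < L 0 z \<and>
      (0 < (cmod z)\<^sup>2 + L 2 z \<longleftrightarrow> sa) \<and> (0 < (cmod z)\<^sup>2 + L 4 z \<longleftrightarrow> sb) \<and> (0 < (cmod z)\<^sup>2 + 2 * L 3 z + 1 \<longleftrightarrow> sd)"
    by blast
  have dec: "decided V {z \<in> U0. Q z}" if "\<And>z. z \<in> V - exceptional \<Longrightarrow> Q z \<longleftrightarrow> s" for Q s
    using that S by (cases s) (auto simp: decided_def)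
  obtain i where "i < 6" and i: "L k = L (0 + i)" using L_index by blast
  then consider "i = 0" | "i = 1" | "i = 2" | "i = 3" | "i = 4" | "i = 5" by linarith
  note ics = this
  have nonneg: "0 \<le> (cmod z)\<^sup>2" for z by simp
  \<comment> \<open>The three bounds settle the inner circle 3 and the outer circles 4 and 2; for
    the remaining indices positivity of the coordinates suffices.\<close>
  have tri: "(cmod z)\<^sup>2 < L 0 z \<and> 0 < (cmod z)\<^sup>2 - 2 * L 1 z + 1 \<and> 0 < (cmod z)\<^sup>2 - 2 * (L 0 z - L 1 z) + 1"
    if z: "z \<in> V - exceptional" for z
  proof -
    define p q where "p = L 0 z" and "q = L 1 z"
    have pq: "0 < q" "q < p" "p < 1" "q < 1" using S[OF z] U0_L[of z 0] U0_L[of z 1] by (simp_all add: p_def q_def)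
    have N: "(cmod z)\<^sup>2 = norm_form p q" using V_values(1)[OF refl refl] by (simp add: p_def q_def)
    have "0 < p * (1 - p)" "0 < q * (p - q)" using pq by simp_all
    then have "norm_form p q < p" by (simp add: norm_form_def algebra_simps)
    moreover have "norm_form p q - 2 * q + 1 = p * (p - q) + (1 - q)\<^sup>2" "norm_form p q - 2 * (p - q) + 1 = p * q + (1 - (p - q))\<^sup>2"
      by (simp_all add: norm_form_def power2_eq_square algebra_simps)
    moreover have "0 < p * (p - q)" "0 < p * q" using pq by simp_all
    ultimately show ?thesis unfolding N p_def[symmetric] q_def[symmetric]
      using zero_le_power2[of "1 - q"] zero_le_power2[of "1 - (p - q)"] by linarith
  qed
  note val = V_values[OF refl refl]
  have vals: "L 2 z = L 1 z - L 0 z" "L 3 z = - L 0 z" "L 4 z = - L 1 z" "L 5 z = L 0 z - L 1 z" for z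
    by (simp_all only: val(4-7))
  show "decided V (half_cut k)"
    unfolding half_cut_def
  proof (rule dec)
    fix z assume "z \<in> V - exceptional"
    note s = S[OF this]
    show "0 < L k z \<longleftrightarrow> i = 0 \<or> i = 1 \<or> i = 5"
      using ics by cases (use s in \<open>simp_all only: i add_0 vals\<close>, simp_all)
  qed
  show "decided V (inner_cut k)"
    unfolding inner_cut_def
  proof (rule dec)
    fix z assume "z \<in> V - exceptional"
    note z = S[OF this] tri[OF this] nonneg[of z]
    have "0 < (cmod z)\<^sup>2 + L 0 z" "0 < (cmod z)\<^sup>2 + L 1 z" "0 < (cmod z)\<^sup>2 + (L 0 z - L 1 z)"
      "\<not> 0 < (cmod z)\<^sup>2 + - L 0 z"
      using z by argo+
    note s = z(1) this
    show "0 < (cmod z)\<^sup>2 + L k z \<longleftrightarrow> i = 0 \<or> i = 1 \<or> i = 5 \<or> (i = 2 \<and> sa) \<or> (i = 4 \<and> sb)"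
      using ics by cases (use s in \<open>simp_all only: i add_0 vals\<close>, simp_all)
  qed
  show "decided V (outer_cut k)"
    unfolding outer_cut_def
  proof (rule dec)
    fix z assume "z \<in> V - exceptional"
    note z = S[OF this] tri[OF this] nonneg[of z]
    have "0 < (cmod z)\<^sup>2 + 2 * L 0 z + 1" "0 < (cmod z)\<^sup>2 + 2 * L 1 z + 1" "0 < (cmod z)\<^sup>2 + 2 * (L 1 z - L 0 z) + 1"
      "0 < (cmod z)\<^sup>2 + 2 * - L 1 z + 1" "0 < (cmod z)\<^sup>2 + 2 * (L 0 z - L 1 z) + 1"
      using z by argo+
    note s = z(1) this
    show "0 < (cmod z)\<^sup>2 + 2 * L k z + 1 \<longleftrightarrow> (i = 3 \<longrightarrow> sd)"
      using ics by cases (use s in \<open>simp_all only: i add_0 vals\<close>, simp_all)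
  qed
qed

lemma decided_V_family:
  assumes "V \<in> V_family"
  shows "decided V (outer_cut k)" "decided V (inner_cut k)" "decided V (half_cut k)"
proof -
  obtain j W where W: "V = (\<lambda>z. zeta ^ j * z) ` W" "W \<in> set base_pieces"
    using assms unfolding V_family_eq by blast
  have "L (k + 5 * j + j) = L k" by (rule L_cong) simp
  note c = L_cong_sets[OF this]
  show "decided V (outer_cut k)" "decided V (inner_cut k)" "decided V (half_cut k)"
    unfolding W(1)
    by (rule decided_rotate[OF decided_base(1)[OF W(2)]], rule rotate_outer_cut[of j _ "k + 5 * j", unfolded c])
       (rule decided_rotate[OF decided_base(2)[OF W(2)]], rule rotate_inner_cut[of j _ "k + 5 * j", unfolded c],
        rule decided_rotate[OF decided_base(3)[OF W(2)]], rule rotate_half_cut[of j _ "k + 5 * j", unfolded c])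
qed

lemma V_family_cover:
  assumes "z \<in> U0" "z \<notin> exceptional"
  shows "\<exists>V\<in>V_family. z \<in> V"
proof -
  obtain j where j: "j < 6" "0 \<le> L (j + 1) z" "0 \<le> L (j + 5) z" using sector by blast
  then have "0 < L (j + 1) z" "0 < L (j + 5) z" using not_exceptional(1)[OF assms(2)] by (metis less_le)+
  define w where "w = z / zeta ^ j"
  have z: "z = zeta ^ j * w" by (simp add: w_def)
  have w: "w \<in> U0" "w \<notin> exceptional" using assms unfolding z rotate_U0 rotate_exceptional .
  have "0 < L 1 w" "0 < L 5 w"
    using \<open>0 < L (j + 1) z\<close> \<open>0 < L (j + 5) z\<close> L_rotate_power[of 1 j w] L_rotate_power[of 5 j w]
    unfolding z by (simp_all only: add.commute)
  then have "0 < L 1 w" "L 1 w < L 0 w" using V_values(7)[OF refl refl, of w] by simp_all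
  note P = V_patterns[OF refl refl, of w]
  have "\<exists>V\<in>set base_pieces. w \<in> V"
    using P(7) P(1-6) w U0_subset_U \<open>0 < L 1 w\<close> \<open>L 1 w < L 0 w\<close> by auto
  then show ?thesis unfolding V_family_eq z using j(1) by blast
qed

lemma region_V_family:
  assumes "G \<in> regions"
  obtains S where "finite S" "S \<subseteq> V_family" "sym_diff G (\<Union>S) \<subseteq> exceptional"
proof -
  have dec: "decided V G" if V: "V \<in> V_family" for V
    using assms
  proof (cases rule: regions_cases)
    case 2
    obtain j W where "V = (\<lambda>z. zeta ^ j * z) ` W" "W \<in> set base_pieces"
      using V unfolding V_family_eq by blast
    then have "V - exceptional \<subseteq> U0" using base_piece_subset U_not_exceptional rotate_exceptional rotate_U0 by blast
    then show ?thesis by (simp add: 2 decided_def)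
  qed (auto simp: decided_def[of _ "{}"] intro: decided_Int decided_V_family[OF V])
  \<comment> \<open>A piece that meets G off the exceptional set is contained in G there, so these
    pieces already cover G up to that set.\<close>
  define S where "S = {V \<in> V_family. V - exceptional \<subseteq> G}"
  have "G - exceptional \<subseteq> \<Union>S"
  proof
    fix z assume z: "z \<in> G - exceptional"
    then obtain V where V: "V \<in> V_family" "z \<in> V" using V_family_cover regions_subset[OF assms] by blast
    then have "V - exceptional \<subseteq> G" using dec[OF V(1)] z unfolding decided_def by blast
    then show "z \<in> \<Union>S" using V by (auto simp: S_def)
  qed
  then have "sym_diff G (\<Union>S) \<subseteq> exceptional" by (auto simp: S_def)
  moreover have "finite S" "S \<subseteq> V_family" using finite_V_family by (auto simp: S_def)
  ultimately show thesis using that by blast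
qed

lemma eq_ae_trans: "eq_ae A B \<Longrightarrow> eq_ae B C \<Longrightarrow> eq_ae A C"
proof -
  assume "eq_ae A B" "eq_ae B C"
  then have "negligible (sym_diff A B \<union> sym_diff B C)"
    unfolding eq_ae_def negligible_iff_null_sets[symmetric] by (rule negligible_Un)
  then show ?thesis
    unfolding eq_ae_def negligible_iff_null_sets[symmetric] by (rule negligible_subset) blast
qed

theorem theorem2:
  shows "(\<forall>as :: complex list. length as \<ge> 1 \<and> admissible as \<and> \<not> full_cylinder as \<longrightarrow>
            (\<exists>k\<in>{1..5}. \<exists>l\<in>{1..6}. eq_ae (cylinder_range as) (U_sets k l)) \<and>
            (\<exists>S. finite S \<and> S \<subseteq> V_family \<and> eq_ae (cylinder_range as) (\<Union>S)))
       \<and> finite {interior (cylinder_range as) | as. length as \<ge> 1 \<and> admissible as}"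
proof (intro conjI allI impI; (elim conjE)?)
  fix as assume as: "admissible as" "\<not> full_cylinder as"
  obtain G where G: "G \<in> regions" "G \<noteq> {}" "interior (cylinder_range as) = G" "eq_ae (cylinder_range as) G"
    using admissible_region[OF as(1)] .
  have "G \<noteq> U0" using as(2) G(3) by (simp add: full_cylinder_def)
  then show "\<exists>k\<in>{1..5}. \<exists>l\<in>{1..6}. eq_ae (cylinder_range as) (U_sets k l)"
    using region_U_sets[OF G(1,2)] G(4) by blast
  obtain S where S: "finite S" "S \<subseteq> V_family" "sym_diff G (\<Union>S) \<subseteq> exceptional"
    using region_V_family[OF G(1)] .
  then have ae: "eq_ae G (\<Union>S)"
    unfolding eq_ae_def negligible_iff_null_sets[symmetric] using negligible_subset[OF negligible_exceptional] by blast
  then show "\<exists>S. finite S \<and> S \<subseteq> V_family \<and> eq_ae (cylinder_range as) (\<Union>S)"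
    using S(1,2) eq_ae_trans[OF G(4) ae] by (intro exI[of _ S] conjI)
next
  have "{interior (cylinder_range as) | as. length as \<ge> 1 \<and> admissible as} \<subseteq> regions"
  proof
    fix X assume "X \<in> {interior (cylinder_range as) | as. length as \<ge> 1 \<and> admissible as}"
    then obtain as where "X = interior (cylinder_range as)" "admissible as" by blast
    then show "X \<in> regions" by (auto elim: admissible_region)
  qed
  then show "finite {interior (cylinder_range as) | as. length as \<ge> 1 \<and> admissible as}"
    by (rule finite_subset[OF _ finite_regions])
qed

end
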